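(* In the setting described in the context, assume that for $\ell$-almost every $t$ the operator $H_t$ is positive semi-definite on $L_{2,t}$ (i.e. $\langle H_tf,f\rangle_{L_{2,t}}\ge0$ for all $f\in L_{2,t}$), and that $\lim_{k\to\infty}\beta_k=0$. Then for every $k\in\mathbb N$, \[ \frac{\mathrm{gap}(U)-\beta_k}{k}\le \mathrm{gap}(H)\le \mathrm{gap}(U). \]
   Context: Let $K\subseteq\mathbb R^d$ be Borel and $\rho:K\to[0,\infty)$ measurable with $0<\int_K\rho\,\mathrm dx<\infty$; $\pi(A)=\int_A\rho\,\mathrm dx/\int_K\rho\,\mathrm dx$. For $t\ge0$, $K(t)=\{x\in K:\rho(x)\ge t\}$, assume $0<\mathrm{vol}_d(K(t))<\infty$ for $t\in(0,\|\rho\|_\infty)$, $U_t$ is the uniform distribution on $K(t)$, and $\ell(s)=\mathrm{vol}_d(K(s))/\int_0^\infty\mathrm{vol}_d(K(r))\,\mathrm dr$. For each $t$, $H_t$ is a Markov kernel on $K(t)$ (extended by $0$ outside $K(t)$, measurable in $(t,x)$), reversible with respect to $U_t$. $L_{2,\pi}=L_2(K,\pi)$, $L_{2,t}=L_2(K(t),U_t)$; $H_t$ acts on $L_{2,t}$ by $H_tf(x)=\int f(y)H_t(x,\mathrm dy)$ and $U_t$ acts by $f\mapsto U_t(f)=\int f\,\mathrm dU_t$. The hybrid slice sampler is $Hf(x)=\frac1{\rho(x)}\int_0^{\rho(x)}H_tf(x)\,\mathrm dt$ and the simple slice sampler is $Uf(x)=\frac1{\rho(x)}\int_0^{\rho(x)}U_t(f)\,\mathrm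 dt$, both on $L_{2,\pi}$. $S(f)=\int_Kf\,\mathrm d\pi$ as an operator onto constants, and $\mathrm{gap}(P)=1-\|P-S\|_{L_{2,\pi}\to L_{2,\pi}}$. Finally $\beta_k=\sup_{x\in K}\big(\int_0^{\rho(x)}\|H_t^k-U_t\|^2_{L_{2,t}\to L_{2,t}}\,\mathrm dt/\rho(x)\big)^{1/2}$. *)

theory Defs
  imports "HOL-Probability.Probability"
begin

definition lvl :: "'a::euclidean_space set \<Rightarrow> ('a \<Rightarrow> real) \<Rightarrow> real \<Rightarrow> 'a set" where
  "lvl K \<rho> t = {x \<in> K. \<rho> x \<ge> t}"

definition pi_meas :: "'a::euclidean_space set \<Rightarrow> ('a \<Rightarrow> real) \<Rightarrow> 'a measure" where
  "pi_meas K \<rho> = density lborel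
     (\<lambda>x. indicator K x * ennreal (\<rho> x) / (\<integral>\<^sup>+y\<in>K. ennreal (\<rho> y) \<partial>lborel))"

definition unif :: "'a::euclidean_space set \<Rightarrow> ('a \<Rightarrow> real) \<Rightarrow> real \<Rightarrow> 'a measure" where
  "unif K \<rho> t = uniform_measure lborel (lvl K \<rho> t)"

definition ell :: "'a::euclidean_space set \<Rightarrow> ('a \<Rightarrow> real) \<Rightarrow> real measure" where
  "ell K \<rho> = density lborel (\<lambda>s. indicator {0..} s * emeasure lborel (lvl K \<rho> s)
      / (\<integral>\<^sup>+r\<in>{0..}. emeasure lborel (lvl K \<rho> r) \<partial>lborel))"

definition rho_sup :: "'a set \<Rightarrow> ('a \<Rightarrow> real) \<Rightarrow> ereal" where
  "rho_sup K \<rho> = (SUP x\<in>K. ereal (\<rho> x))"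

definition L2space :: "'a measure \<Rightarrow> ('a \<Rightarrow> real) set" where
  "L2space M = {f \<in> borel_measurable M. (\<integral>\<^sup>+x. ennreal ((f x)\<^sup>2) \<partial>M) < \<infinity>}"

definition L2ball :: "'a measure \<Rightarrow> ('a \<Rightarrow> real) set" where
  "L2ball M = {f \<in> borel_measurable M. (\<integral>\<^sup>+x. ennreal ((f x)\<^sup>2) \<partial>M) \<le> 1}"

definition opnorm :: "'a measure \<Rightarrow> (('a \<Rightarrow> real) \<Rightarrow> ('a \<Rightarrow> real)) \<Rightarrow> real" where
  "opnorm M P = sqrt (enn2real (SUP f\<in>L2ball M. \<integral>\<^sup>+x. ennreal ((P f x)\<^sup>2) \<partial>M))"

definition kop :: "(real \<Rightarrow> 'a \<Rightarrow> 'a measure) \<Rightarrow> real \<Rightarrow> ('a \<Rightarrow> real) \<Rightarrow> 'a \<Rightarrow> real" where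
  "kop H t f x = (\<integral>y. f y \<partial>(H t x))"

definition kpow :: "(real \<Rightarrow> 'a \<Rightarrow> 'a measure) \<Rightarrow> real \<Rightarrow> nat \<Rightarrow> ('a \<Rightarrow> real) \<Rightarrow> 'a \<Rightarrow> real" where
  "kpow H t k = (kop H t) ^^ k"

definition hybrid :: "('a \<Rightarrow> real) \<Rightarrow> (real \<Rightarrow> 'a \<Rightarrow> 'a measure) \<Rightarrow> ('a \<Rightarrow> real) \<Rightarrow> 'a \<Rightarrow> real" where
  "hybrid \<rho> H f x = (\<integral>t\<in>{0..\<rho> x}. kop H t f x \<partial>lborel) / \<rho> x"

definition simple_slice :: "'a::euclidean_space set \<Rightarrow> ('a \<Rightarrow> real) \<Rightarrow> ('a \<Rightarrow> real) \<Rightarrow> 'a \<Rightarrow> real" where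
  "simple_slice K \<rho> f x = (\<integral>t\<in>{0..\<rho> x}. (\<integral>y. f y \<partial>unif K \<rho> t) \<partial>lborel) / \<rho> x"

definition gap :: "'a measure \<Rightarrow> (('a \<Rightarrow> real) \<Rightarrow> ('a \<Rightarrow> real)) \<Rightarrow> real" where
  "gap M P = 1 - opnorm M (\<lambda>f x. P f x - (\<integral>y. f y \<partial>M))"

definition beta :: "'a::euclidean_space set \<Rightarrow> ('a \<Rightarrow> real) \<Rightarrow> (real \<Rightarrow> 'a \<Rightarrow> 'a measure) \<Rightarrow> nat \<Rightarrow> real" where
  "beta K \<rho> H k = (SUP x\<in>K. sqrt (enn2real (\<integral>\<^sup>+t\<in>{0..\<rho> x}.
      ennreal ((opnorm (unif K \<rho> t) (\<lambda>f y. kpow H t k f y - (\<integral>z. f z \<partial>unif K \<rho> t)))\<^sup>2) \<partial>lborel)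
      / \<rho> x))"

end

theory Submission
  imports Defs
begin

text \<open>
  Disintegrating over levels, \<open>\<langle>Hf, f\<rangle>\<^sub>\<pi> = \<integral> \<langle>H\<^sub>t f, f\<rangle>\<^sub>t \<ell>(dt)\<close> and
  \<open>\<langle>Uf, f\<rangle>\<^sub>\<pi> = \<integral> U\<^sub>t(f)\<^sup>2 \<ell>(dt)\<close>. Both \<open>H - S\<close> and \<open>U - S\<close> are positive semi-definite, so their
  norms are the suprema of their quadratic forms.

  Positivity of \<open>H\<^sub>t\<close> on \<open>f - U\<^sub>t(f)\<close> gives \<open>U\<^sub>t(f)\<^sup>2 \<le> \<langle>H\<^sub>t f, f\<rangle>\<^sub>t\<close>, hence the upper bound.

  For the lower bound, the moments \<open>m\<^sub>j = \<langle>H\<^sub>t\<^sup>j f, f\<rangle>\<^sub>t\<close> are convex in \<open>j\<close>, so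
  \<open>k (m\<^sub>1 - m\<^sub>0) \<le> m\<^sub>k - m\<^sub>0\<close>. Writing \<open>H\<^sub>t\<^sup>k = U\<^sub>t + (H\<^sub>t\<^sup>k - U\<^sub>t)\<close> and integrating,
  \<open>\<integral> m\<^sub>k d\<ell> \<le> \<langle>Uf, f\<rangle>\<^sub>\<pi> + \<beta>\<^sub>k \<parallel>f\<parallel>\<^sup>2\<close>, so that
  \<open>\<langle>(H - S)f, f\<rangle> \<le> (1 - (gap U - \<beta>\<^sub>k) / k) \<parallel>f\<parallel>\<^sup>2\<close>.
\<close>

section \<open>Symmetric operators on square-integrable functions\<close>

text \<open>No spectral theorem is involved. That the norm of a positive symmetric operator is the
  supremum of its form follows from one positivity test at \<open>f - A f / b\<close>. Positivity of
  \<open>H - S\<close> is the inequality \<open>(mean f)^2 <= <H f, f>\<close>, the same one that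
  compares \<open>U_t\<close> with \<open>H_t\<close> on a slice. The simple sampler is handled as
  the hybrid sampler with \<open>H_t = U_t\<close>, so all facts about \<open>H - S\<close> are
  inherited by \<open>U - S\<close>. The disintegration comes from describing normalised Lebesgue
  measure under the graph of \<rho> over \<open>K\<close> in two ways: state from \<pi>, then level
  uniform on \<open>[0, \<rho> x]\<close>; or level from \<open>ell\<close>, then state from
  \<open>U_t\<close>. Signed integrals are exchanged only after reduction to nonnegative ones. The
  passage to \<beta> is the delicate point: \<beta> bounds averages over the levels below one state,
  whereas the forms are averaged over all levels, and operator norms may fail to be measurable in
  the level. The extra term \<open>S(f)^2\<close> in the form of \<open>U\<close> is harmless
  because it can be enlarged to \<open>k S(f)^2\<close>, which is exactly what subtracting
  \<open>S\<close> from \<open>H\<close> absorbs.\<close>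

definition ip :: "'a measure \<Rightarrow> ('a \<Rightarrow> real) \<Rightarrow> ('a \<Rightarrow> real) \<Rightarrow> real" where
  "ip M f g = (\<integral>x. f x * g x \<partial>M)"

lemma L2space_measurable [measurable_dest]: "f \<in> L2space M \<Longrightarrow> f \<in> borel_measurable M"
  by (simp add: L2space_def)

lemma L2space_iff_integrable:
  "f \<in> L2space M \<longleftrightarrow> f \<in> borel_measurable M \<and> integrable M (\<lambda>x. (f x)\<^sup>2)"
  by (auto simp: L2space_def integrable_iff_bounded)

lemma abs_mult_le_sum_squares: "\<bar>a * b\<bar> \<le> a\<^sup>2 + b\<^sup>2" for a b :: real
  using sum_squares_bound[of "\<bar>a\<bar>" "\<bar>b\<bar>"] mult_nonneg_nonneg[OF abs_ge_zero[of a] abs_ge_zero[of b]]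
  unfolding abs_mult power2_abs by linarith

lemma integrable_L2_mult:
  assumes "f \<in> L2space M" "g \<in> L2space M"
  shows "integrable M (\<lambda>x. f x * g x)"
proof (rule Bochner_Integration.integrable_bound[where f="\<lambda>x. (f x)\<^sup>2 + (g x)\<^sup>2"])
  show "integrable M (\<lambda>x. (f x)\<^sup>2 + (g x)\<^sup>2)"
    using assms by (auto simp: L2space_iff_integrable)
  show "AE x in M. norm (f x * g x) \<le> norm ((f x)\<^sup>2 + (g x)\<^sup>2)"
    using abs_mult_le_sum_squares by simp
qed (use assms in measurable)

lemma L2space_cmult: "f \<in> L2space M \<Longrightarrow> (\<lambda>x. c * f x) \<in> L2space M"
  by (auto simp: L2space_iff_integrable power_mult_distrib)

lemma L2space_add: "f \<in> L2space M \<Longrightarrow> g \<in> L2space M \<Longrightarrow> (\<lambda>x. f x + g x) \<in> L2space M"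
  using integrable_L2_mult[of f M g]
  by (auto simp: L2space_iff_integrable power2_sum mult.assoc)

lemma L2space_diff: "f \<in> L2space M \<Longrightarrow> g \<in> L2space M \<Longrightarrow> (\<lambda>x. f x - g x) \<in> L2space M"
  using L2space_add[of f M "\<lambda>x. -1 * g x"] L2space_cmult[of g M "-1"] by simp

lemma L2space_const: "finite_measure M \<Longrightarrow> (\<lambda>x. c) \<in> L2space M"
  by (auto simp: L2space_iff_integrable finite_measure.integrable_const)

lemma nn_integral_square_L2:
  "f \<in> L2space M \<Longrightarrow> (\<integral>\<^sup>+x. ennreal ((f x)\<^sup>2) \<partial>M) = ennreal (ip M f f)"
  by (subst nn_integral_eq_integral)
     (auto simp: L2space_iff_integrable ip_def power2_eq_square)

lemma L2spaceI:
  "f \<in> borel_measurable M \<Longrightarrow> (\<integral>\<^sup>+x. ennreal ((f x)\<^sup>2) \<partial>M) \<le> ennreal c \<Longrightarrow> f \<in> L2space M"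
  by (auto simp: L2space_def intro: le_less_trans)

lemma ip_commute: "ip M f g = ip M g f"
  by (simp add: ip_def mult.commute)

lemma ip_nonneg: "0 \<le> ip M f f"
  by (simp add: ip_def)

lemma ip_le_iff_nn_integral:
  assumes "f \<in> L2space M" "0 \<le> c"
  shows "ip M f f \<le> c \<longleftrightarrow> (\<integral>\<^sup>+x. ennreal ((f x)\<^sup>2) \<partial>M) \<le> ennreal c"
  using assms by (simp add: nn_integral_square_L2)

context
  fixes M :: "'a measure" and f g h :: "'a \<Rightarrow> real"
  assumes fgh: "f \<in> L2space M" "g \<in> L2space M" "h \<in> L2space M"
begin

lemma ip_add_left: "ip M (\<lambda>x. f x + g x) h = ip M f h + ip M g h"
  and ip_diff_left: "ip M (\<lambda>x. f x - g x) h = ip M f h - ip M g h"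
  using integrable_L2_mult[OF fgh(1,3)] integrable_L2_mult[OF fgh(2,3)]
  by (simp_all add: ip_def ring_distribs)

lemma ip_diff_right: "ip M h (\<lambda>x. f x - g x) = ip M h f - ip M h g"
  using ip_diff_left by (simp only: ip_commute[of M h])

end

lemma ip_cmult_left: "ip M (\<lambda>x. c * f x) g = c * ip M f g"
  by (simp add: ip_def mult.assoc)

lemma ip_cmult_right: "ip M g (\<lambda>x. c * f x) = c * ip M g f"
  by (simp add: ip_def mult.left_commute)

text \<open>Cauchy-Schwarz in arithmetic-geometric form: expand the squared norm of
  \<open>f - c b g\<close> for \<open>c = 1\<close> and \<open>c = -1\<close>. The free weight
  \<open>b\<close> replaces square roots and is chosen at each use so that the two halves
  balance.\<close>

lemma ip_le_weighted:
  assumes "f \<in> L2space M" "g \<in> L2space M" "0 < b"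
  shows "\<bar>ip M f g\<bar> \<le> (ip M f f / b + b * ip M g g) / 2"
proof -
  have *: "2 * c * ip M f g \<le> ip M f f / b + b * ip M g g" if c: "c = 1 \<or> c = -1" for c :: real
  proof -
    let ?h = "\<lambda>x. f x - (c * b) * g x"
    have L: "(\<lambda>x. (c * b) * g x) \<in> L2space M" "?h \<in> L2space M"
      using assms by (auto intro!: L2space_diff L2space_cmult)
    have "0 \<le> ip M ?h ?h" by (rule ip_nonneg)
    also have "ip M ?h ?h = ip M f f - 2 * (c * b) * ip M f g + (c * b)\<^sup>2 * ip M g g"
      using assms L
      by (simp add: ip_diff_left ip_diff_right ip_cmult_left ip_cmult_right ip_commute[of M g f]
          power2_eq_square algebra_simps)
    also have "(c * b)\<^sup>2 = b * b" using c by (auto simp: power2_eq_square)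
    finally have "2 * c * b * ip M f g \<le> ip M f f + b * b * ip M g g" by (simp add: algebra_simps)
    then show ?thesis using \<open>0 < b\<close> by (simp add: field_simps)
  qed
  from *[of 1] *[of "-1"] show ?thesis by simp
qed

text \<open>Linearity can be left out: whenever \<open>A\<close> is applied to a difference,
  symmetry moves it to the other factor of \<open>ip\<close>, and the difference is expanded there.
  For kernel operators this avoids additivity of integrals that exist only almost
  everywhere.\<close>

definition sym_op :: "'a measure \<Rightarrow> (('a \<Rightarrow> real) \<Rightarrow> 'a \<Rightarrow> real) \<Rightarrow> bool" where
  "sym_op M A \<longleftrightarrow> (\<forall>f\<in>L2space M. A f \<in> L2space M) \<and>
     (\<forall>f\<in>L2space M. \<forall>g\<in>L2space M. ip M (A f) g = ip M f (A g))"

definition psd_op :: "'a measure \<Rightarrow> (('a \<Rightarrow> real) \<Rightarrow> 'a \<Rightarrow> real) \<Rightarrow> bool" where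
  "psd_op M A \<longleftrightarrow> (\<forall>f\<in>L2space M. 0 \<le> ip M (A f) f)"

lemma sym_opD:
  assumes "sym_op M A" "f \<in> L2space M"
  shows "A f \<in> L2space M" "g \<in> L2space M \<Longrightarrow> ip M (A f) g = ip M f (A g)"
  using assms by (auto simp: sym_op_def)

lemma sym_op_funpow:
  assumes "sym_op M A"
  shows "sym_op M (A ^^ j)"
proof (induction j)
  case 0
  then show ?case by (simp add: sym_op_def)
next
  case (Suc j)
  then show ?case
    using assms unfolding sym_op_def by (simp add: funpow_swap1)
qed

text \<open>Symmetry moves half of the power to the other factor. An even power leaves a squared
  norm, an odd one leaves the form of \<open>A\<close> at \<open>(A ^^ i) f\<close>.\<close>

lemma psd_op_funpow:
  assumes "sym_op M A" "psd_op M A"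
  shows "psd_op M (A ^^ j)"
  unfolding psd_op_def
proof
  fix f assume f: "f \<in> L2space M"
  note L = sym_opD[OF sym_op_funpow[OF assms(1)]]
  obtain i where "j = i + i \<or> j = i + Suc i"
    by (rule that[of "j div 2"]) presburger
  then show "0 \<le> ip M ((A ^^ j) f) f"
  proof
    assume "j = i + i"
    then have "ip M ((A ^^ j) f) f = ip M ((A ^^ i) f) ((A ^^ i) f)"
      using L(2)[OF L(1)[OF f] f, of i i] by (simp add: funpow_add)
    then show ?thesis by (simp add: ip_nonneg)
  next
    assume "j = i + Suc i"
    then have "ip M ((A ^^ j) f) f = ip M (A ((A ^^ i) f)) ((A ^^ i) f)"
      using L(2)[OF L(1)[OF f, of "Suc i"] f, of i] by (simp add: funpow_swap1 funpow_add)
    then show ?thesis using assms(2) L(1)[OF f] by (simp add: psd_op_def)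
  qed
qed

text \<open>The moments \<open>m j = \<langle>A^j f, f\<rangle>\<close> form a convex sequence, because
  \<open>m j - 2 m (j+1) + m (j+2) = \<langle>A^j (f - A f), f - A f\<rangle>\<close>.\<close>

lemma psd_moment_bernoulli:
  assumes A: "sym_op M A" "psd_op M A" and f: "f \<in> L2space M"
  shows "real k * (ip M (A f) f - ip M f f) \<le> ip M ((A ^^ k) f) f - ip M f f"
proof -
  define m where "m j = ip M ((A ^^ j) f) f" for j
  note S = sym_opD[OF sym_op_funpow[OF A(1)]]
  have Af: "A f \<in> L2space M" using A f by (simp add: sym_opD)
  define g where "g = (\<lambda>x. f x - A f x)"
  have g: "g \<in> L2space M" unfolding g_def using f Af by (rule L2space_diff)
  have shift: "ip M (A f) ((A ^^ j) f) = m (Suc j)" for j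
    using sym_opD(2)[OF A(1) S(1)[OF f] f, of j] by (simp add: m_def ip_commute)
  have convex: "0 \<le> m j - 2 * m (Suc j) + m (Suc (Suc j))" for j
  proof -
    have "0 \<le> ip M ((A ^^ j) g) g"
      using psd_op_funpow[OF A] g by (simp add: psd_op_def)
    also have "\<dots> = ip M ((A ^^ j) g) f - ip M ((A ^^ j) g) (A f)"
      using S(1)[OF g, of j] f Af by (simp add: g_def ip_diff_right)
    also have "ip M ((A ^^ j) g) f = m j - m (Suc j)"
      using S(1)[OF f] S(2)[OF g f] f Af shift
      by (simp add: g_def ip_diff_left) (simp add: m_def ip_commute)
    also have "ip M ((A ^^ j) g) (A f) = m (Suc j) - m (Suc (Suc j))"
    proof -
      have "ip M ((A ^^ j) g) (A f) = ip M g ((A ^^ Suc j) f)"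
        using S(2)[OF g Af, of j] by (simp add: funpow_swap1)
      also have "\<dots> = m (Suc j) - m (Suc (Suc j))"
        using S(1)[OF f, of "Suc j"] f Af shift[of "Suc j"] unfolding g_def
        by (subst ip_diff_left) (auto simp add: m_def ip_commute)
      finally show ?thesis .
    qed
    finally show ?thesis by simp
  qed
  \<comment> \<open>Convexity makes every increment at least the first, and telescoping yields the
    claim. For multiplication by a scalar \<open>a >= 0\<close> it is Bernoulli's inequality
    \<open>k (a - 1) <= a^k - 1\<close>.\<close>
  have slope: "m 1 - m 0 \<le> m (Suc j) - m j" for j
    by (induction j) (use convex in \<open>auto, smt (verit)\<close>)
  have "real k * (m 1 - m 0) \<le> m k - m 0"
    by (induction k) (use slope in \<open>auto simp: algebra_simps, smt (verit)\<close>)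
  then show ?thesis by (simp add: m_def)
qed

section \<open>Operator norms and quadratic forms\<close>

lemma opnorm_nonneg: "0 \<le> opnorm M P"
  by (simp add: opnorm_def)

lemma opnorm_le:
  assumes "0 \<le> r" "\<And>f. f \<in> L2ball M \<Longrightarrow> (\<integral>\<^sup>+x. ennreal ((P f x)\<^sup>2) \<partial>M) \<le> ennreal (r\<^sup>2)"
  shows "opnorm M P \<le> r"
proof -
  have "(SUP f\<in>L2ball M. \<integral>\<^sup>+x. ennreal ((P f x)\<^sup>2) \<partial>M) \<le> ennreal (r\<^sup>2)"
    by (rule SUP_least) (rule assms)
  then have "enn2real (SUP f\<in>L2ball M. \<integral>\<^sup>+x. ennreal ((P f x)\<^sup>2) \<partial>M) \<le> r\<^sup>2"
    by (simp add: enn2real_leI)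
  then show ?thesis
    unfolding opnorm_def using assms(1) by (simp add: real_le_lsqrt)
qed

lemma L2ball_iff: "f \<in> L2ball M \<longleftrightarrow> f \<in> L2space M \<and> ip M f f \<le> 1"
proof
  assume f: "f \<in> L2ball M"
  then have "f \<in> L2space M" by (auto simp: L2ball_def L2space_def intro: le_less_trans)
  with f show "f \<in> L2space M \<and> ip M f f \<le> 1"
    by (simp add: nn_integral_square_L2 L2ball_def)
next
  assume "f \<in> L2space M \<and> ip M f f \<le> 1"
  then show "f \<in> L2ball M"
    by (simp add: nn_integral_square_L2 L2ball_def L2space_measurable)
qed

text \<open>The bound \<open>C\<close> is needed because an infinite operator norm has the junk value \<open>0\<close>.\<close>

lemma ip_le_opnorm:
  assumes hom: "\<And>c f. P (\<lambda>x. c * f x) = (\<lambda>x. c * P f x)"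
    and maps: "\<And>f. f \<in> L2space M \<Longrightarrow> P f \<in> L2space M"
    and bound: "\<And>f. f \<in> L2space M \<Longrightarrow> ip M (P f) (P f) \<le> C * ip M f f"
    and f: "f \<in> L2space M"
  shows "ip M (P f) (P f) \<le> (opnorm M P)\<^sup>2 * ip M f f"
proof (cases "ip M f f = 0")
  case True
  with bound[OF f] show ?thesis by simp
next
  case False
  then have pos: "0 < ip M f f" using ip_nonneg[of M f] by simp
  \<comment> \<open>Functions of norm zero are settled by \<open>bound\<close>; any other is scaled
    to the unit sphere, where the supremum applies, and \<open>hom\<close> scales back.\<close>
  define c where "c = 1 / sqrt (ip M f f)"
  have c2: "c * c = 1 / ip M f f" using pos by (simp add: c_def)
  let ?S = "SUP f\<in>L2ball M. \<integral>\<^sup>+x. ennreal ((P f x)\<^sup>2) \<partial>M"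
  have "?S \<le> ennreal \<bar>C\<bar>"
  proof (rule SUP_least)
    fix g assume g: "g \<in> L2ball M"
    then have "ip M (P g) (P g) \<le> C * ip M g g" using bound by (simp add: L2ball_iff)
    also have "\<dots> \<le> \<bar>C\<bar> * 1"
      using g ip_nonneg[of M g] by (intro mult_mono) (auto simp: L2ball_iff)
    finally show "(\<integral>\<^sup>+x. ennreal ((P g x)\<^sup>2) \<partial>M) \<le> ennreal \<bar>C\<bar>"
      using g maps by (simp add: L2ball_iff nn_integral_square_L2 ennreal_leI)
  qed
  then have fin: "?S < \<top>" by (rule le_less_trans) simp
  have opn: "(opnorm M P)\<^sup>2 = enn2real ?S"
    by (simp add: opnorm_def)
  let ?h = "\<lambda>x. c * f x"
  have hb: "?h \<in> L2ball M"
    using f pos c2 by (simp add: L2ball_iff L2space_cmult ip_cmult_left ip_cmult_right flip: mult.assoc)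
  then have "(\<integral>\<^sup>+x. ennreal ((P ?h x)\<^sup>2) \<partial>M) \<le> ?S" by (rule SUP_upper)
  also have "\<dots> = ennreal ((opnorm M P)\<^sup>2)" using fin opn by simp
  finally have "ip M (P ?h) (P ?h) \<le> (opnorm M P)\<^sup>2"
    using hb maps by (simp add: L2ball_iff nn_integral_square_L2)
  also have "ip M (P ?h) (P ?h) = ip M (P f) (P f) / ip M f f"
    using c2 by (simp add: hom ip_cmult_left ip_cmult_right flip: mult.assoc)
  finally show ?thesis using pos by (simp add: field_simps)
qed

lemma quadratic_form_le_opnorm:
  assumes hom: "\<And>c f. P (\<lambda>x. c * f x) = (\<lambda>x. c * P f x)"
    and maps: "\<And>f. f \<in> L2space M \<Longrightarrow> P f \<in> L2space M"
    and bound: "\<And>f. f \<in> L2space M \<Longrightarrow> ip M (P f) (P f) \<le> C * ip M f f"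
    and f: "f \<in> L2space M"
  shows "ip M (P f) f \<le> opnorm M P * ip M f f"
proof (rule field_le_epsilon)
  fix e :: real assume "0 < e"
  \<comment> \<open>Cauchy-Schwarz is wanted with weight \<open>opnorm M P\<close>, which may be 0.
    The perturbation makes the weight positive, and its denominator keeps the resulting error
    \<open>e * (n / (n + 1))\<close>, with \<open>n = ip M f f\<close>, below
    \<open>e\<close>.\<close>
  define b where "b = opnorm M P + e / (ip M f f + 1)"
  have nn: "0 \<le> ip M f f" by (rule ip_nonneg)
  have b: "0 < b" "opnorm M P \<le> b"
    using \<open>0 < e\<close> nn opnorm_nonneg[of M P] by (auto simp: b_def add_nonneg_pos)
  have "ip M (P f) f \<le> (ip M (P f) (P f) / b + b * ip M f f) / 2"
    using ip_le_weighted[OF maps[OF f] f b(1)] by simp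
  also have "ip M (P f) (P f) / b \<le> b * ip M f f"
  proof -
    have "ip M (P f) (P f) \<le> (opnorm M P)\<^sup>2 * ip M f f"
      by (rule ip_le_opnorm[OF hom maps bound f])
    also have "\<dots> \<le> b\<^sup>2 * ip M f f"
      using b nn opnorm_nonneg[of M P] by (intro mult_right_mono power_mono) auto
    finally show ?thesis using b by (simp add: field_simps power2_eq_square)
  qed
  also have "(b * ip M f f + b * ip M f f) / 2 = opnorm M P * ip M f f + e * (ip M f f / (ip M f f + 1))"
    by (simp add: b_def algebra_simps)
  also have "e * (ip M f f / (ip M f f + 1)) \<le> e"
    using \<open>0 < e\<close> nn by (simp add: field_simps)
  finally show "ip M (P f) f \<le> opnorm M P * ip M f f + e" by simp
qed

text \<open>In essence this is Cauchy-Schwarz for the semi-inner product \<open><A f, g>\<close> at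
  \<open>f\<close> and \<open>g = A f\<close>, condensed into a single positivity test. The slack
  \<open>e\<close> keeps the divisor \<open>b\<close> positive when \<open>r = 0\<close>.\<close>

lemma opnorm_le_quadratic_form:
  assumes A: "sym_op M A" "psd_op M A" and "0 \<le> r"
    and r: "\<And>f. f \<in> L2space M \<Longrightarrow> ip M (A f) f \<le> r * ip M f f"
  shows "opnorm M A \<le> r"
proof (rule field_le_epsilon)
  fix e :: real assume "0 < e"
  define b where "b = r + e"
  have b: "0 < b" "r \<le> b" using \<open>0 < e\<close> \<open>0 \<le> r\<close> by (auto simp: b_def)
  have "opnorm M A \<le> b"
  proof (rule opnorm_le)
    show "0 \<le> b" using b by simp
    fix f assume "f \<in> L2ball M"
    then have f: "f \<in> L2space M" "ip M f f \<le> 1" by (auto simp: L2ball_iff)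
    define g where "g = A f"
    have g: "g \<in> L2space M" "A g \<in> L2space M" unfolding g_def using sym_opD(1)[OF A(1)] f(1) by blast+
    \<comment> \<open>Positivity at \<open>f - g / b\<close> reads
      \<open>0 <= <g, f> - 2 |g|^2 / b + <A g, g> / b^2\<close>. Bounding the two outer terms
      through \<open>r <= b\<close> leaves \<open>|g|^2 / b <= b |f|^2\<close>.\<close>
    define h where "h = (\<lambda>x. f x - (1 / b) * g x)"
    have cg: "(\<lambda>x. (1 / b) * g x) \<in> L2space M" using g by (simp only: L2space_cmult)
    have h: "h \<in> L2space M"
      unfolding h_def using f(1) cg by (rule L2space_diff)
    have expand: "ip M h u = ip M f u - (1 / b) * ip M g u" if "u \<in> L2space M" for u
      unfolding h_def using ip_diff_left[OF f(1) cg that] by (simp only: ip_cmult_left)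
    have "0 \<le> ip M (A h) h" using A h by (simp add: psd_op_def)
    also have "\<dots> = ip M (A h) f - (1 / b) * ip M (A h) g"
      using expand[OF sym_opD(1)[OF A(1) h]] by (simp only: ip_commute[of M "A h"])
    also have "ip M (A h) f = ip M f g - (1 / b) * ip M g g"
      using sym_opD(2)[OF A(1) h f(1)] expand[OF g(1)] by (simp add: g_def)
    also have "ip M (A h) g = ip M g g - (1 / b) * ip M (A g) g"
    proof -
      have "ip M (A h) g = ip M h (A g)" using A h g by (simp add: sym_opD)
      also have "\<dots> = ip M f (A g) - (1 / b) * ip M g (A g)"
        using g(2) by (rule expand)
      also have "ip M f (A g) = ip M g g" using sym_opD(2)[OF A(1) f(1) g(1)] by (simp add: g_def)
      finally show ?thesis by (simp add: ip_commute)
    qed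
    finally have "0 \<le> ip M f g - 2 * (ip M g g / b) + ip M (A g) g / b\<^sup>2"
      by (simp add: algebra_simps power2_eq_square)
    moreover have "ip M f g \<le> b * ip M f f"
      using r[OF f(1)] mult_right_mono[OF b(2) ip_nonneg[of M f]] by (simp add: g_def ip_commute)
    moreover have "ip M (A g) g / b\<^sup>2 \<le> ip M g g / b"
    proof -
      have "ip M (A g) g \<le> b * ip M g g"
        using r[OF g(1)] mult_right_mono[OF b(2) ip_nonneg[of M g]] by simp
      then show ?thesis using b by (simp add: field_simps power2_eq_square)
    qed
    ultimately have "ip M g g / b \<le> b * ip M f f" by linarith
    then have "ip M g g \<le> b\<^sup>2 * ip M f f" using b by (simp add: field_simps power2_eq_square)
    also have "\<dots> \<le> b\<^sup>2 * 1" using f(2) by (intro mult_left_mono) auto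
    finally show "(\<integral>\<^sup>+x. ennreal ((A f x)\<^sup>2) \<partial>M) \<le> ennreal (b\<^sup>2)"
      using g unfolding g_def by (simp add: nn_integral_square_L2 ennreal_leI)
  qed
  then show "opnorm M A \<le> r + e" by (simp add: b_def)
qed

section \<open>Reversible kernels\<close>

text \<open>Jensen's inequality for the square, by nonnegativity of the variance. If
  \<open>h\<close> is not square integrable the right side is infinite, so measurability
  suffices.\<close>

lemma prob_space_square_integral_le:
  assumes "prob_space N" and h[measurable]: "h \<in> borel_measurable N"
  shows "ennreal ((\<integral>x. h x \<partial>N)\<^sup>2) \<le> (\<integral>\<^sup>+x. ennreal ((h x)\<^sup>2) \<partial>N)"
proof (cases "h \<in> L2space N")
  case True
  interpret prob_space N by fact
  define c where "c = (\<integral>x. h x \<partial>N)"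
  have one: "(\<lambda>x. c) \<in> L2space N" by (rule L2space_const) unfold_locales
  have ih: "integrable N h"
    using integrable_L2_mult[OF True L2space_const[of N 1]] finite_measure_axioms by simp
  have "0 \<le> ip N (\<lambda>x. h x - c) (\<lambda>x. h x - c)" by (rule ip_nonneg)
  also have "\<dots> = ip N h h - c\<^sup>2"
    using True one L2space_diff[OF True one] ih
    by (simp add: ip_diff_left ip_diff_right)
       (simp add: ip_def c_def power2_eq_square prob_space)
  finally have "c\<^sup>2 \<le> ip N h h" by simp
  then show ?thesis using True by (simp add: nn_integral_square_L2 c_def ennreal_leI)
next
  case False
  then show ?thesis by (simp add: L2space_def less_top[symmetric])
qed

text \<open>The integrand varies with \<open>x\<close>. Pushing \<open>L x\<close> forward along
  \<open>y \<mapsto> (x, y)\<close> turns it into one fixed function integrated against a varying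
  measure.\<close>

lemma integral_measurable_kernel:
  fixes f :: "'a \<Rightarrow> 'b \<Rightarrow> real"
  assumes f[measurable]: "case_prod f \<in> borel_measurable (M \<Otimes>\<^sub>M N)"
    and L[measurable]: "L \<in> measurable M (subprob_algebra N)"
  shows "(\<lambda>x. \<integral>y. f x y \<partial>L x) \<in> borel_measurable M"
proof -
  note integral_measurable_subprob_algebra[measurable] measurable_distr2[measurable]
  have "(\<lambda>x. integral\<^sup>L (distr (L x) (M \<Otimes>\<^sub>M N) (\<lambda>y. (x, y))) (case_prod f)) \<in> borel_measurable M"
    by measurable
  then show ?thesis
    by (rule measurable_cong[THEN iffD1, rotated]) (simp add: integral_distr)
qed

text \<open>The bridge from signed to nonnegative integrals: an iterated Bochner integral becomes a
  difference of two iterated nonnegative ones, so that exchange identities have to be proved only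
  for \<open>nn_integral\<close>.\<close>

lemma kernel_integral:
  fixes F :: "'a \<Rightarrow> 'b \<Rightarrow> real"
  assumes F[measurable]: "case_prod F \<in> borel_measurable (M \<Otimes>\<^sub>M N)"
    and L[measurable]: "L \<in> measurable M (subprob_algebra N)"
    and fin: "(\<integral>\<^sup>+x. \<integral>\<^sup>+y. ennreal \<bar>F x y\<bar> \<partial>L x \<partial>M) < \<infinity>"
  shows integrable_kernel_integral: "integrable M (\<lambda>x. \<integral>y. F x y \<partial>L x)"
    and AE_integrable_kernel: "AE x in M. integrable (L x) (F x)"
    and integral_kernel_eq: "(\<integral>x. \<integral>y. F x y \<partial>L x \<partial>M) =
      enn2real (\<integral>\<^sup>+x. \<integral>\<^sup>+y. ennreal (F x y) \<partial>L x \<partial>M)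
      - enn2real (\<integral>\<^sup>+x. \<integral>\<^sup>+y. ennreal (- F x y) \<partial>L x \<partial>M)"
proof -
  have slice: "F x \<in> borel_measurable (L x)" if "x \<in> space M" for x
    unfolding subprob_measurableD(3)[OF L that] using measurable_Pair2[OF F that] by simp
  have meas: "(\<lambda>x. \<integral>\<^sup>+y. g (F x y) \<partial>L x) \<in> borel_measurable M"
    if [measurable]: "g \<in> borel_measurable borel" for g :: "real \<Rightarrow> ennreal"
    by (rule nn_integral_measurable_subprob_algebra2[OF _ L]) measurable
  have m[measurable]: "(\<lambda>x. \<integral>\<^sup>+y. ennreal \<bar>F x y\<bar> \<partial>L x) \<in> borel_measurable M"
    "(\<lambda>x. \<integral>\<^sup>+y. ennreal (F x y) \<partial>L x) \<in> borel_measurable M"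
    "(\<lambda>x. \<integral>\<^sup>+y. ennreal (- F x y) \<partial>L x) \<in> borel_measurable M"
    using meas[of "\<lambda>r. ennreal \<bar>r\<bar>"] meas[of ennreal] meas[of "\<lambda>r. ennreal (- r)"] by simp_all
  have "AE x in M. (\<integral>\<^sup>+y. ennreal \<bar>F x y\<bar> \<partial>L x) \<noteq> \<infinity>"
    by (rule nn_integral_noteq_infinite) (use fin in auto)
  then show AEi: "AE x in M. integrable (L x) (F x)"
    using AE_space
  proof eventually_elim
    case (elim x)
    then show ?case
      by (intro integrableI_bounded slice) (simp_all add: less_top[symmetric])
  qed
  have le: "(\<integral>\<^sup>+y. ennreal (F x y) \<partial>L x) \<le> (\<integral>\<^sup>+y. ennreal \<bar>F x y\<bar> \<partial>L x)"
    "(\<integral>\<^sup>+y. ennreal (- F x y) \<partial>L x) \<le> (\<integral>\<^sup>+y. ennreal \<bar>F x y\<bar> \<partial>L x)" for x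
    by (auto intro!: nn_integral_mono ennreal_leI)
  \<comment> \<open>\<open>G\<close> may be infinite on a null set, where \<open>enn2real\<close>
    returns 0; the integrals do not see this.\<close>
  have part: "integrable M (\<lambda>x. enn2real (G x)) \<and> (\<integral>x. enn2real (G x) \<partial>M) = enn2real (\<integral>\<^sup>+x. G x \<partial>M)"
    if G[measurable]: "G \<in> borel_measurable M" and Gle: "\<And>x. G x \<le> (\<integral>\<^sup>+y. ennreal \<bar>F x y\<bar> \<partial>L x)" for G
  proof -
    have f: "(\<integral>\<^sup>+x. G x \<partial>M) < \<infinity>"
      by (rule le_less_trans[OF nn_integral_mono fin]) (rule Gle)
    then have "AE x in M. G x \<noteq> \<infinity>" by (intro nn_integral_noteq_infinite) auto
    then have "(\<integral>\<^sup>+x. ennreal (enn2real (G x)) \<partial>M) = (\<integral>\<^sup>+x. G x \<partial>M)"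
      by (intro nn_integral_cong_AE) (auto simp: less_top[symmetric])
    then show ?thesis
      using f by (auto intro!: integrableI_nonneg simp: integral_eq_nn_integral)
  qed
  note p1 = part[of "\<lambda>x. \<integral>\<^sup>+y. ennreal (F x y) \<partial>L x", OF m(2) le(1)]
  note p2 = part[of "\<lambda>x. \<integral>\<^sup>+y. ennreal (- F x y) \<partial>L x", OF m(3) le(2)]
  let ?D = "\<lambda>x. enn2real (\<integral>\<^sup>+y. ennreal (F x y) \<partial>L x) - enn2real (\<integral>\<^sup>+y. ennreal (- F x y) \<partial>L x)"
  have [measurable]: "(\<lambda>x. \<integral>y. F x y \<partial>L x) \<in> borel_measurable M"
    by (rule integral_measurable_kernel[OF F L])
  have eq: "AE x in M. ?D x = (\<integral>y. F x y \<partial>L x)"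
    using AEi by eventually_elim (simp add: real_lebesgue_integral_def)
  have "integrable M ?D" using p1 p2 by (intro Bochner_Integration.integrable_diff) blast+
  then show "integrable M (\<lambda>x. \<integral>y. F x y \<partial>L x)"
    by (rule integrable_cong_AE[THEN iffD1, rotated 3]) (measurable, rule eq)
  have "(\<integral>x. \<integral>y. F x y \<partial>L x \<partial>M) = (\<integral>x. ?D x \<partial>M)"
    by (rule integral_cong_AE, measurable, use eq in eventually_elim) simp
  then show "(\<integral>x. \<integral>y. F x y \<partial>L x \<partial>M) =
      enn2real (\<integral>\<^sup>+x. \<integral>\<^sup>+y. ennreal (F x y) \<partial>L x \<partial>M)
      - enn2real (\<integral>\<^sup>+x. \<integral>\<^sup>+y. ennreal (- F x y) \<partial>L x \<partial>M)"
    using p1 p2 by (simp only: Bochner_Integration.integral_diff)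
qed

text \<open>The Markov property is asked only almost everywhere because the intended kernels may
  vanish off the level set, which is a null set for the uniform distribution on it.\<close>

locale reversible_kernel = prob_space M for M :: "'a measure" +
  fixes Q :: "'a \<Rightarrow> 'a measure"
  assumes kernel[measurable]: "Q \<in> measurable M (subprob_algebra M)"
    and AE_prob: "AE x in M. prob_space (Q x)"
    and reversible: "\<And>A B. A \<in> sets M \<Longrightarrow> B \<in> sets M \<Longrightarrow>
      (\<integral>\<^sup>+x. indicator A x * emeasure (Q x) B \<partial>M) = (\<integral>\<^sup>+x. indicator B x * emeasure (Q x) A \<partial>M)"
begin

abbreviation (input) op :: "('a \<Rightarrow> real) \<Rightarrow> 'a \<Rightarrow> real" where
  "op f x \<equiv> \<integral>y. f y \<partial>Q x"

lemma measurable_slice: "x \<in> space M \<Longrightarrow> f \<in> borel_measurable M \<Longrightarrow> f \<in> borel_measurable (Q x)"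
  using subprob_measurableD(3)[OF kernel] by blast

lemma measurable_op [measurable]: "f \<in> borel_measurable M \<Longrightarrow> op f \<in> borel_measurable M"
  by (rule integral_measurable_kernel[OF _ kernel])
     (simp add: split_beta' measurable_compose[OF measurable_snd])

lemma measurable_nn_op [measurable]:
  "f \<in> borel_measurable M \<Longrightarrow> (\<lambda>x. \<integral>\<^sup>+y. f y \<partial>Q x) \<in> borel_measurable M"
  by (rule nn_integral_measurable_subprob_algebra2[OF _ kernel])
     (simp add: split_beta' measurable_compose[OF measurable_snd])

text \<open>The hypothesis \<open>eq\<close> says that the measures
  \<open>density M w \<bind> Q\<close> and \<open>density M v\<close> agree on every set.
  Integrating \<open>f\<close> against both passes from sets to functions in one stroke.\<close>

lemma nn_integral_weighted_kernel:
  assumes w[measurable]: "w \<in> borel_measurable M" and v[measurable]: "v \<in> borel_measurable M"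
    and eq: "\<And>B. B \<in> sets M \<Longrightarrow>
      (\<integral>\<^sup>+x. w x * emeasure (Q x) B \<partial>M) = (\<integral>\<^sup>+x. indicator B x * v x \<partial>M)"
    and f[measurable]: "f \<in> borel_measurable M"
  shows "(\<integral>\<^sup>+x. w x * (\<integral>\<^sup>+y. f y \<partial>Q x) \<partial>M) = (\<integral>\<^sup>+x. f x * v x \<partial>M)"
proof -
  have ne: "space (density M w) \<noteq> {}" using not_empty by simp
  have k: "Q \<in> measurable (density M w) (subprob_algebra M)" by simp
  have "density M w \<bind> Q = density M v"
  proof (rule measure_eqI)
    show sets: "sets (density M w \<bind> Q) = sets (density M v)"
      using sets_bind[OF _ ne, of Q M] subprob_measurableD(2)[OF kernel] by simp
    fix B assume "B \<in> sets (density M w \<bind> Q)"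
    then have B[measurable]: "B \<in> sets M" using sets by simp
    have "emeasure (density M w \<bind> Q) B = (\<integral>\<^sup>+x. w x * emeasure (Q x) B \<partial>M)"
      by (subst emeasure_bind[OF ne k B]) (simp add: nn_integral_density)
    also have "\<dots> = emeasure (density M v) B"
      by (simp add: eq emeasure_density mult.commute)
    finally show "emeasure (density M w \<bind> Q) B = emeasure (density M v) B" .
  qed
  then have "(\<integral>\<^sup>+x. f x \<partial>(density M w \<bind> Q)) = (\<integral>\<^sup>+x. f x \<partial>density M v)" by simp
  then show ?thesis
    by (simp add: nn_integral_bind[OF f k] nn_integral_density mult.commute)
qed

lemma nn_reversible:
  assumes f[measurable]: "f \<in> borel_measurable M" and g[measurable]: "g \<in> borel_measurable M"
  shows "(\<integral>\<^sup>+x. g x * (\<integral>\<^sup>+y. f y \<partial>Q x) \<partial>M) = (\<integral>\<^sup>+x. f x * (\<integral>\<^sup>+y. g y \<partial>Q x) \<partial>M)"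
proof (rule nn_integral_weighted_kernel)
  fix B assume B[measurable]: "B \<in> sets M"
  \<comment> \<open>The previous lemma is used twice: here to replace one indicator in
    \<open>reversible\<close> by \<open>g\<close>, and in the enclosing step to replace the other by
    \<open>f\<close>.\<close>
  have "(\<integral>\<^sup>+x. indicator B x * (\<integral>\<^sup>+y. g y \<partial>Q x) \<partial>M) = (\<integral>\<^sup>+x. g x * emeasure (Q x) B \<partial>M)"
    by (rule nn_integral_weighted_kernel) (measurable, rule reversible, auto)
  then show "(\<integral>\<^sup>+x. g x * emeasure (Q x) B \<partial>M) = (\<integral>\<^sup>+x. indicator B x * (\<integral>\<^sup>+y. g y \<partial>Q x) \<partial>M)" ..
qed measurable

lemma nn_stationary:
  assumes f[measurable]: "f \<in> borel_measurable M"
  shows "(\<integral>\<^sup>+x. \<integral>\<^sup>+y. f y \<partial>Q x \<partial>M) = (\<integral>\<^sup>+x. f x \<partial>M)"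
proof -
  have "(\<integral>\<^sup>+x. \<integral>\<^sup>+y. f y \<partial>Q x \<partial>M) = (\<integral>\<^sup>+x. f x * (\<integral>\<^sup>+y. 1 \<partial>Q x) \<partial>M)"
    using nn_reversible[OF f, of "\<lambda>_. 1"] by simp
  also have "\<dots> = (\<integral>\<^sup>+x. f x \<partial>M)"
    by (rule nn_integral_cong_AE, use AE_prob in eventually_elim)
       (simp add: prob_space.emeasure_space_1)
  finally show ?thesis .
qed

text \<open>Jensen for \<open>Q x\<close> bounds the square of the average by the average of the
  square; stationarity then removes \<open>Q\<close>.\<close>

lemma op_contraction:
  assumes f: "f \<in> L2space M"
  shows "op f \<in> L2space M" "ip M (op f) (op f) \<le> ip M f f"
proof -
  note [measurable] = L2space_measurable[OF f]
  have "(\<integral>\<^sup>+x. ennreal ((op f x)\<^sup>2) \<partial>M) \<le> (\<integral>\<^sup>+x. \<integral>\<^sup>+y. ennreal ((f y)\<^sup>2) \<partial>Q x \<partial>M)"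
    by (rule nn_integral_mono_AE, use AE_prob AE_space in eventually_elim)
       (auto intro!: prob_space_square_integral_le measurable_slice[OF _ L2space_measurable[OF f]])
  also have "\<dots> = ennreal (ip M f f)"
    using f by (subst nn_stationary) (auto simp: nn_integral_square_L2)
  finally have le: "(\<integral>\<^sup>+x. ennreal ((op f x)\<^sup>2) \<partial>M) \<le> ennreal (ip M f f)" .
  then show L: "op f \<in> L2space M" by (rule L2spaceI[rotated]) measurable
  show "ip M (op f) (op f) \<le> ip M f f"
    using le L by (simp add: ip_le_iff_nn_integral ip_nonneg)
qed

lemma op_one: "AE x in M. op (\<lambda>_. c) x = c"
  using AE_prob by eventually_elim (simp add: prob_space.prob_space)

text \<open>Both terms on the right are nonnegative iterated integrals, to which
  \<open>nn_reversible_signed\<close> applies. Absolute convergence follows from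
  \<open>|a b| <= a^2 + b^2\<close> and stationarity.\<close>

lemma ip_op_eq:
  assumes f: "f \<in> L2space M" and g: "g \<in> L2space M"
  shows "ip M (op f) g =
      enn2real (\<integral>\<^sup>+x. \<integral>\<^sup>+y. ennreal (g x * f y) \<partial>Q x \<partial>M)
      - enn2real (\<integral>\<^sup>+x. \<integral>\<^sup>+y. ennreal (- (g x * f y)) \<partial>Q x \<partial>M)"
proof -
  note [measurable] = L2space_measurable[OF f] L2space_measurable[OF g]
  have "(\<integral>\<^sup>+x. \<integral>\<^sup>+y. ennreal \<bar>g x * f y\<bar> \<partial>Q x \<partial>M)
      \<le> (\<integral>\<^sup>+x. ennreal ((g x)\<^sup>2) + (\<integral>\<^sup>+y. ennreal ((f y)\<^sup>2) \<partial>Q x) \<partial>M)"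
  proof (rule nn_integral_mono_AE, use AE_prob AE_space in eventually_elim)
    case (elim x)
    interpret Qx: prob_space "Q x" by fact
    note [measurable] = measurable_slice[OF elim(2) L2space_measurable[OF f]]
    have "(\<integral>\<^sup>+y. ennreal \<bar>g x * f y\<bar> \<partial>Q x) \<le> (\<integral>\<^sup>+y. ennreal ((g x)\<^sup>2) + ennreal ((f y)\<^sup>2) \<partial>Q x)"
      by (intro nn_integral_mono) (simp add: abs_mult_le_sum_squares flip: ennreal_plus)
    also have "\<dots> = ennreal ((g x)\<^sup>2) + (\<integral>\<^sup>+y. ennreal ((f y)\<^sup>2) \<partial>Q x)"
      by (subst nn_integral_add) (auto simp: Qx.emeasure_space_1)
    finally show ?case .
  qed
  also have "\<dots> = ennreal (ip M g g) + ennreal (ip M f f)"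
    using f g by (subst nn_integral_add) (auto simp: nn_stationary nn_integral_square_L2)
  also have "\<dots> < \<infinity>" by simp
  finally have fin: "(\<integral>\<^sup>+x. \<integral>\<^sup>+y. ennreal \<bar>g x * f y\<bar> \<partial>Q x \<partial>M) < \<infinity>" .
  have "ip M (op f) g = (\<integral>x. \<integral>y. g x * f y \<partial>Q x \<partial>M)"
    by (simp add: ip_def mult.commute)
  also have "\<dots> = enn2real (\<integral>\<^sup>+x. \<integral>\<^sup>+y. ennreal (g x * f y) \<partial>Q x \<partial>M)
      - enn2real (\<integral>\<^sup>+x. \<integral>\<^sup>+y. ennreal (- (g x * f y)) \<partial>Q x \<partial>M)"
    by (rule integral_kernel_eq[OF _ kernel fin]) measurable
  finally show ?thesis .
qed

text \<open>\<open>ennreal\<close> truncates at 0, so the statement concerns the positive part of a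
  product. That part is the product of the positive parts plus the product of the negative parts,
  and each summand is reversible.\<close>

lemma nn_reversible_signed:
  assumes f[measurable]: "f \<in> borel_measurable M" and g[measurable]: "g \<in> borel_measurable M"
  shows "(\<integral>\<^sup>+x. \<integral>\<^sup>+y. ennreal (g x * f y) \<partial>Q x \<partial>M) = (\<integral>\<^sup>+x. \<integral>\<^sup>+y. ennreal (f x * g y) \<partial>Q x \<partial>M)"
proof -
  have split: "ennreal (a * b) = ennreal a * ennreal b + ennreal (- a) * ennreal (- b)" for a b :: real
  proof -
    consider "0 \<le> a" "0 \<le> b" | "0 \<le> a" "b \<le> 0" | "a \<le> 0" "0 \<le> b" | "a \<le> 0" "b \<le> 0" by linarith
    then show ?thesis
    proof cases
      case 4
      then have "ennreal (a * b) = ennreal (- a) * ennreal (- b)" by (simp flip: ennreal_mult)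
      with 4 show ?thesis by (simp add: ennreal_neg)
    qed (simp_all add: ennreal_neg ennreal_mult mult_nonneg_nonpos mult_nonpos_nonneg)
  qed
  have *: "(\<integral>\<^sup>+x. \<integral>\<^sup>+y. ennreal (u x * w y) \<partial>Q x \<partial>M)
     = (\<integral>\<^sup>+x. ennreal (u x) * (\<integral>\<^sup>+y. ennreal (w y) \<partial>Q x) \<partial>M)
       + (\<integral>\<^sup>+x. ennreal (- u x) * (\<integral>\<^sup>+y. ennreal (- w y) \<partial>Q x) \<partial>M)"
    if [measurable]: "u \<in> borel_measurable M" "w \<in> borel_measurable M" for u w
  proof -
    have "(\<integral>\<^sup>+y. ennreal (u x * w y) \<partial>Q x) = ennreal (u x) * (\<integral>\<^sup>+y. ennreal (w y) \<partial>Q x)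
       + ennreal (- u x) * (\<integral>\<^sup>+y. ennreal (- w y) \<partial>Q x)" if x: "x \<in> space M" for x
    proof -
      note [measurable] = measurable_slice[OF x, of w, OF \<open>w \<in> borel_measurable M\<close>]
      show ?thesis unfolding split[of "u x"]
        by (subst nn_integral_add) (auto simp: nn_integral_cmult)
    qed
    then have "(\<integral>\<^sup>+x. \<integral>\<^sup>+y. ennreal (u x * w y) \<partial>Q x \<partial>M) = (\<integral>\<^sup>+x. ennreal (u x) * (\<integral>\<^sup>+y. ennreal (w y) \<partial>Q x)
       + ennreal (- u x) * (\<integral>\<^sup>+y. ennreal (- w y) \<partial>Q x) \<partial>M)"
      by (rule nn_integral_cong)
    also have "\<dots> = (\<integral>\<^sup>+x. ennreal (u x) * (\<integral>\<^sup>+y. ennreal (w y) \<partial>Q x) \<partial>M)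
       + (\<integral>\<^sup>+x. ennreal (- u x) * (\<integral>\<^sup>+y. ennreal (- w y) \<partial>Q x) \<partial>M)"
      by (rule nn_integral_add) measurable
    finally show ?thesis .
  qed
  show ?thesis
    unfolding *[OF f g] *[OF g f]
    using nn_reversible[of "\<lambda>x. ennreal (f x)" "\<lambda>x. ennreal (g x)"]
      nn_reversible[of "\<lambda>x. ennreal (- f x)" "\<lambda>x. ennreal (- g x)"] by simp
qed

lemma sym_op_op: "sym_op M op"
  unfolding sym_op_def
proof (intro conjI ballI)
  fix f assume f: "f \<in> L2space M"
  show "op f \<in> L2space M" by (rule op_contraction[OF f])
  fix g assume g: "g \<in> L2space M"
  note [measurable] = L2space_measurable[OF f] L2space_measurable[OF g]
  have "ip M (op f) g = ip M (op g) f"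
    unfolding ip_op_eq[OF f g] ip_op_eq[OF g f]
    using nn_reversible_signed[of f g] nn_reversible_signed[of f "\<lambda>x. - g x"]
      by (simp)
  then show "ip M (op f) g = ip M f (op g)" by (simp add: ip_commute)
qed

lemma integral_op: "f \<in> L2space M \<Longrightarrow> (\<integral>x. op f x \<partial>M) = (\<integral>x. f x \<partial>M)"
proof -
  assume f: "f \<in> L2space M"
  note [measurable] = L2space_measurable[OF f]
  have one: "(\<lambda>x. 1) \<in> L2space M" by (rule L2space_const) unfold_locales
  have "ip M (op f) (\<lambda>x. 1) = ip M f (op (\<lambda>x. 1))"
    using sym_opD(2)[OF sym_op_op f one] .
  also have "\<dots> = (\<integral>x. f x \<partial>M)"
    unfolding ip_def
    by (rule integral_cong_AE, measurable, use op_one[of 1] in eventually_elim) simp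
  finally show ?thesis by (simp add: ip_def)
qed

end

section \<open>Disintegration of the target over levels\<close>

text \<open>If \<open>A\<close> has measure 0 or infinity, the quotient is 0 in
  \<open>ennreal\<close>. Hence degenerate level sets need no exception when \<open>unif\<close> is
  treated as a kernel on the whole line.\<close>

lemma subprob_space_uniform_measure:
  assumes "A \<in> sets M" "space M \<noteq> {}"
  shows "subprob_space (uniform_measure M A)"
proof
  have "emeasure (uniform_measure M A) (space M) = emeasure M A / emeasure M A"
    using assms(1) by (simp add: Int_absorb2 sets.sets_into_space)
  also have "\<dots> \<le> 1"
    by (cases "emeasure M A = 0 \<or> emeasure M A = \<top>") (auto simp: ennreal_divide_self less_top[symmetric])
  finally show "emeasure (uniform_measure M A) (space (uniform_measure M A)) \<le> 1" by simp
qed (use assms in simp)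

text \<open>On a fixed set the kernel is a ratio of section measures of product-measurable sets, and
  section measures depend measurably on the base point.\<close>

lemma (in sigma_finite_measure) measurable_uniform_measure_kernel:
  assumes E[measurable]: "E \<in> sets (N \<Otimes>\<^sub>M M)" and ne: "space M \<noteq> {}"
  shows "(\<lambda>x. uniform_measure M (Pair x -` E)) \<in> measurable N (subprob_algebra M)"
proof (rule measurable_subprob_algebra)
  fix A assume A[measurable]: "A \<in> sets M"
  have "Pair x -` E \<inter> A = Pair x -` (E \<inter> (space N \<times> A))" if "x \<in> space N" for x
    using that by auto
  moreover have "Pair x -` E \<in> sets M" for x by (rule sets_Pair1[OF E])
  ultimately have "emeasure (uniform_measure M (Pair x -` E)) A
      = emeasure M (Pair x -` (E \<inter> (space N \<times> A))) / emeasure M (Pair x -` E)" if "x \<in> space N" for x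
    using that by simp
  moreover have "(\<lambda>x. emeasure M (Pair x -` (E \<inter> (space N \<times> A))) / emeasure M (Pair x -` E)) \<in> borel_measurable N"
    by (intro borel_measurable_divide_ennreal measurable_emeasure_Pair) auto
  ultimately show "(\<lambda>x. emeasure (uniform_measure M (Pair x -` E)) A) \<in> borel_measurable N"
    by (simp cong: measurable_cong)
qed (use ne sets_Pair1[OF E] in \<open>auto intro!: subprob_space_uniform_measure\<close>)

locale slice_density =
  fixes K :: "'a::euclidean_space set" and \<rho> :: "'a \<Rightarrow> real"
  assumes K_borel[measurable]: "K \<in> sets borel"
    and \<rho>_meas[measurable]: "\<rho> \<in> borel_measurable borel"
    and \<rho>_nonneg: "\<And>x. x \<in> K \<Longrightarrow> 0 \<le> \<rho> x"
    and int_pos: "0 < (\<integral>\<^sup>+x\<in>K. ennreal (\<rho> x) \<partial>lborel)"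
    and int_fin: "(\<integral>\<^sup>+x\<in>K. ennreal (\<rho> x) \<partial>lborel) < \<infinity>"
    and vol: "\<And>t. 0 < t \<Longrightarrow> ereal t < rho_sup K \<rho> \<Longrightarrow>
               0 < emeasure lborel (lvl K \<rho> t) \<and> emeasure lborel (lvl K \<rho> t) < \<infinity>"
begin

abbreviation "\<pi> \<equiv> pi_meas K \<rho>"
abbreviation "U \<equiv> unif K \<rho>"
abbreviation "\<L> \<equiv> ell K \<rho>"
abbreviation "Z \<equiv> (\<integral>\<^sup>+x\<in>K. ennreal (\<rho> x) \<partial>lborel)"

text \<open>These are the levels about which the hypotheses on volumes and kernels speak; they turn
  out to be almost all levels for \<open>ell\<close>.\<close>

definition regular :: "real \<Rightarrow> bool" where
  "regular t \<longleftrightarrow> 0 < t \<and> ereal t < rho_sup K \<rho>"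

text \<open>The conditional law of the level given the current state \<open>x\<close>.\<close>

definition height :: "'a \<Rightarrow> real measure" where
  "height x = (if 0 < \<rho> x then uniform_measure lborel {0..\<rho> x} else null_measure lborel)"

lemma sets_pi [simp, measurable_cong]: "sets \<pi> = sets borel" and space_pi [simp]: "space \<pi> = UNIV"
  by (simp_all add: pi_meas_def)

lemma sets_unif [simp, measurable_cong]: "sets (U t) = sets borel" and space_unif [simp]: "space (U t) = UNIV"
  by (simp_all add: unif_def)

lemma sets_ell [simp, measurable_cong]: "sets \<L> = sets borel" and space_ell [simp]: "space \<L> = UNIV"
  by (simp_all add: ell_def)

lemma sets_height [simp, measurable_cong]: "sets (height x) = sets borel" and space_height [simp]: "space (height x) = UNIV"
  by (simp_all add: height_def)

lemma lvl_graph [measurable]: "{p. snd p \<in> lvl K \<rho> (fst p)} \<in> sets (borel \<Otimes>\<^sub>M borel)"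
proof -
  have "{p \<in> space (borel \<Otimes>\<^sub>M borel). snd p \<in> K \<and> fst p \<le> \<rho> (snd p)} \<in> sets (borel \<Otimes>\<^sub>M borel)"
    by measurable
  then show ?thesis by (simp add: lvl_def space_pair_measure)
qed

lemma lvl_borel [measurable]: "lvl K \<rho> t \<in> sets borel"
proof -
  have "{x \<in> space borel. x \<in> K \<and> t \<le> \<rho> x} \<in> sets borel" by measurable
  then show ?thesis by (simp add: lvl_def)
qed

lemma subprob_algebra_unif [simp]: "subprob_algebra (U t) = subprob_algebra borel"
  by (rule subprob_algebra_cong) simp

lemma unif_kernel [measurable]: "U \<in> measurable borel (subprob_algebra borel)"
proof -
  have "(\<lambda>t. uniform_measure lborel (Pair t -` {p. snd p \<in> lvl K \<rho> (fst p)}))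
      \<in> measurable borel (subprob_algebra lborel)"
    by (rule lborel.measurable_uniform_measure_kernel) (auto simp: lvl_graph cong: sets_pair_measure_cong)
  also have "subprob_algebra lborel = (subprob_algebra borel :: 'a measure measure)"
    by (rule subprob_algebra_cong) simp
  finally show ?thesis by (simp add: unif_def[abs_def] vimage_def)
qed

lemma height_kernel [measurable]: "height \<in> measurable borel (subprob_algebra borel)"
proof -
  have eq: "subprob_algebra lborel = (subprob_algebra borel :: real measure measure)"
    by (rule subprob_algebra_cong) simp
  have E: "{p :: 'a \<times> real. 0 \<le> snd p \<and> snd p \<le> \<rho> (fst p)} \<in> sets (borel \<Otimes>\<^sub>M lborel)"
  proof -
    have "{p \<in> space (borel \<Otimes>\<^sub>M lborel). 0 \<le> snd p \<and> snd p \<le> \<rho> (fst p)} \<in> sets (borel \<Otimes>\<^sub>M lborel)"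
      by measurable
    then show ?thesis by (simp add: space_pair_measure)
  qed
  have "(\<lambda>x. uniform_measure lborel (Pair x -` {p. 0 \<le> snd p \<and> snd p \<le> \<rho> (fst p)}))
      \<in> measurable borel (subprob_algebra lborel)"
    by (rule lborel.measurable_uniform_measure_kernel[OF E]) auto
  moreover have "Pair x -` {p. 0 \<le> snd p \<and> snd p \<le> \<rho> (fst p)} = {0..\<rho> x}" for x by auto
  ultimately have [measurable]: "(\<lambda>x. uniform_measure lborel {0..\<rho> x}) \<in> measurable borel (subprob_algebra borel)"
    by (simp add: eq)
  have [measurable]: "(\<lambda>x. null_measure lborel) \<in> measurable borel (subprob_algebra (borel::real measure))"
    by (rule measurable_const) (auto simp: space_subprob_algebra intro!: subprob_spaceI)
  show ?thesis unfolding height_def by measurable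
qed

lemma prob_space_height: "0 < \<rho> x \<Longrightarrow> prob_space (height x)"
  by (auto simp: height_def intro!: prob_space_uniform_measure)

lemma prob_space_unif: "regular t \<Longrightarrow> prob_space (U t)"
  using vol[of t] by (auto simp: unif_def regular_def intro!: prob_space_uniform_measure)

lemma AE_unif_lvl: "AE x in U t. x \<in> lvl K \<rho> t"
  unfolding unif_def by (rule AE_uniform_measureI) auto

lemma prob_space_pi: "prob_space \<pi>"
proof
  have "emeasure \<pi> (space \<pi>) = (\<integral>\<^sup>+x. indicator K x * ennreal (\<rho> x) / Z \<partial>lborel)"
    by (simp add: pi_meas_def emeasure_density)
  also have "\<dots> = (\<integral>\<^sup>+x. ennreal (\<rho> x) * indicator K x \<partial>lborel) / Z"
    by (subst nn_integral_divide[symmetric]) (auto simp: mult.commute)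
  also have "\<dots> = 1" using int_pos int_fin by (intro ennreal_divide_self) auto
  finally show "emeasure \<pi> (space \<pi>) = 1" .
qed

lemma AE_pi: "AE x in \<pi>. x \<in> K \<and> 0 < \<rho> x"
  unfolding pi_meas_def by (subst AE_density) (auto simp: indicator_def not_le[symmetric] ennreal_neg intro!: AE_I2)

section \<open>Almost every level, and the two disintegrations\<close>

lemma AE_regular_or_empty: "AE t in lborel. 0 < t \<longrightarrow> regular t \<or> lvl K \<rho> t = {}"
proof -
  \<comment> \<open>At the supremum itself the level set can be nonempty without being covered by
    \<open>vol\<close>, so this one level is discarded. If the supremum is infinite,
    \<open>real_of_ereal\<close> is 0 and the exclusion is harmless.\<close>
  have "AE t in lborel. t \<noteq> real_of_ereal (rho_sup K \<rho>)" by (rule AE_lborel_singleton)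
  then show ?thesis
  proof eventually_elim
    case (elim t)
    have "\<rho> x < t" if "x \<in> K" "0 < t" "\<not> regular t" for x
    proof -
      have "ereal (\<rho> x) \<le> rho_sup K \<rho>" unfolding rho_sup_def using that by (intro SUP_upper)
      moreover have "rho_sup K \<rho> \<le> ereal t" using that by (simp add: regular_def not_less)
      ultimately show ?thesis using elim by (cases "rho_sup K \<rho>") auto
    qed
    then show ?case by (force simp: lvl_def not_le)
  qed
qed

lemma measurable_lvl_restrict:
  assumes F[measurable]: "case_prod F \<in> borel_measurable (borel \<Otimes>\<^sub>M borel)"
  shows "(\<lambda>(t, x). F t x * (indicator {0..} t * indicator (lvl K \<rho> t) x) :: ennreal)
    \<in> borel_measurable (lborel \<Otimes>\<^sub>M lborel)"
proof -
  have eq: "(\<lambda>(t, x). F t x * (indicator {0..} t * indicator (lvl K \<rho> t) x))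
    = (\<lambda>p. case_prod F p * (indicator {0..} (fst p) * indicator {p. snd p \<in> lvl K \<rho> (fst p)} p))"
    by (auto simp: fun_eq_iff indicator_def)
  have "(\<lambda>(t, x). F t x * (indicator {0..} t * indicator (lvl K \<rho> t) x))
    \<in> borel_measurable (borel \<Otimes>\<^sub>M borel)"
    unfolding eq by measurable
  then show ?thesis
    by (simp cong: measurable_cong_sets sets_pair_measure_cong)
qed

lemma nn_integral_swap_lvl:
  assumes F: "case_prod F \<in> borel_measurable (borel \<Otimes>\<^sub>M borel)"
  shows "(\<integral>\<^sup>+t. \<integral>\<^sup>+x. F t x * (indicator {0..} t * indicator (lvl K \<rho> t) x) \<partial>lborel \<partial>lborel)
    = (\<integral>\<^sup>+x. \<integral>\<^sup>+t. F t x * (indicator {0..} t * indicator (lvl K \<rho> t) x) \<partial>lborel \<partial>(lborel :: 'a measure))"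
  using lborel_pair.Fubini[OF measurable_lvl_restrict[OF F]] by simp

text \<open>Both sides are the volume under the graph of \<rho>. Thus \<pi> and \<open>ell\<close>
  share their normalising constant, which the disintegration relies on.\<close>

lemma layer_cake: "(\<integral>\<^sup>+r\<in>{0..}. emeasure lborel (lvl K \<rho> r) \<partial>lborel) = Z"
proof -
  have "(\<integral>\<^sup>+r\<in>{0..}. emeasure lborel (lvl K \<rho> r) \<partial>lborel)
      = (\<integral>\<^sup>+t. \<integral>\<^sup>+x. 1 * (indicator {0..} t * indicator (lvl K \<rho> t) x) \<partial>lborel \<partial>lborel)"
    by (simp add: nn_integral_cmult mult.commute)
  also have "\<dots> = (\<integral>\<^sup>+x. \<integral>\<^sup>+t. 1 * (indicator {0..} t * indicator (lvl K \<rho> t) x) \<partial>lborel \<partial>lborel)"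
    by (rule nn_integral_swap_lvl) measurable
  also have "\<dots> = Z"
  proof (rule nn_integral_cong)
    fix x :: 'a
    have "(\<integral>\<^sup>+t. 1 * (indicator {0..} t * indicator (lvl K \<rho> t) x) \<partial>lborel)
        = (\<integral>\<^sup>+t. indicator {0..\<rho> x} t * indicator K x \<partial>lborel)"
      by (rule nn_integral_cong) (auto simp: lvl_def indicator_def)
    also have "\<dots> = ennreal (\<rho> x) * indicator K x"
      using \<rho>_nonneg[of x] by (cases "x \<in> K") (simp_all add: nn_integral_multc)
    finally show "(\<integral>\<^sup>+t. 1 * (indicator {0..} t * indicator (lvl K \<rho> t) x) \<partial>lborel)
        = ennreal (\<rho> x) * indicator K x" .
  qed
  finally show ?thesis .
qed

lemma measurable_vol [measurable]: "(\<lambda>t. emeasure lborel (lvl K \<rho> t)) \<in> borel_measurable borel"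
proof -
  have "{p. snd p \<in> lvl K \<rho> (fst p)} \<in> sets (borel \<Otimes>\<^sub>M (lborel :: 'a measure))"
    using lvl_graph by (simp cong: sets_pair_measure_cong)
  from lborel.measurable_emeasure_Pair[OF this] show ?thesis by (simp add: vimage_def)
qed

lemma ell_eq: "\<L> = density lborel (\<lambda>s. indicator {0..} s * emeasure lborel (lvl K \<rho> s) / Z)"
  by (simp add: ell_def layer_cake)

text \<open>The density of \<open>ell\<close> is positive exactly at the regular levels, up to a
  null set. The passage to Lebesgue measure is needed because \<open>beta\<close> integrates over
  levels with \<open>lborel\<close>.\<close>

lemma AE_ell_iff: "(AE t in \<L>. P t) \<longleftrightarrow> (AE t in lborel. regular t \<longrightarrow> P t)"
proof -
  have "(AE t in \<L>. P t) \<longleftrightarrow>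
      (AE t in lborel. 0 < indicator {0..} t * emeasure lborel (lvl K \<rho> t) / Z \<longrightarrow> P t)"
    unfolding ell_eq by (subst AE_density) auto
  also have "\<dots> \<longleftrightarrow> (AE t in lborel. regular t \<longrightarrow> P t)"
  proof (rule eventually_subst)
    have "AE t in lborel. t \<noteq> (0::real)" by (rule AE_lborel_singleton)
    with AE_regular_or_empty
    show "AE t in lborel. (0 < indicator {0..} t * emeasure lborel (lvl K \<rho> t) / Z \<longrightarrow> P t) = (regular t \<longrightarrow> P t)"
    proof eventually_elim
      case (elim t)
      consider "t < 0" | "0 < t" "lvl K \<rho> t = {}" | "regular t" using elim by linarith
      then show ?case
      proof cases
        case 3
        then show ?thesis
          using vol[of t] int_fin by (auto simp: regular_def ennreal_zero_less_divide)
      qed (use vol[of t] in \<open>auto simp: regular_def\<close>)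
    qed
  qed
  finally show ?thesis .
qed

lemma AE_ell_regular: "AE t in \<L>. regular t"
  by (simp add: AE_ell_iff)

text \<open>Both sides integrate \<open>F\<close> over the region under the graph, divided by
  \<open>Z\<close>: the density of \<pi> cancels the length of the interval in
  \<open>height x\<close>, and the density of \<open>ell\<close> cancels the volume in
  \<open>U t\<close>. Tonelli identifies the results.\<close>

lemma nn_integral_slice_fubini:
  assumes F[measurable]: "case_prod F \<in> borel_measurable (borel \<Otimes>\<^sub>M borel)"
  shows "(\<integral>\<^sup>+x. \<integral>\<^sup>+t. F t x \<partial>height x \<partial>\<pi>) = (\<integral>\<^sup>+t. \<integral>\<^sup>+x. F t x \<partial>U t \<partial>\<L>)"
proof -
  let ?c = "\<lambda>t x. F t x * (indicator {0..} t * indicator (lvl K \<rho> t) x)"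
  have F': "(\<lambda>(x, t). F t x) \<in> borel_measurable (borel \<Otimes>\<^sub>M borel)"
    using measurable_pair_swap[OF F] by (simp add: split_beta')
  note c = measurable_lvl_restrict[OF F]
  have c1[measurable]: "(\<lambda>t. \<integral>\<^sup>+x. ?c t x \<partial>lborel) \<in> borel_measurable lborel"
    by (rule lborel.borel_measurable_nn_integral[OF c])
  have c2[measurable]: "(\<lambda>x. \<integral>\<^sup>+t. ?c t x \<partial>lborel) \<in> borel_measurable lborel"
    by (rule lborel.borel_measurable_nn_integral) (use measurable_pair_swap[OF c] in \<open>simp add: split_beta'\<close>)
  have cancel: "(a / z) * (b / a) = b / z" if "a \<noteq> 0" "a \<noteq> \<top>" for a b z :: ennreal
  proof -
    have "(a / z) * (b / a) = (b / z) * (a / a)" by (simp add: divide_ennreal_def ac_simps)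
    then show ?thesis using that by (simp add: ennreal_divide_self less_top[symmetric])
  qed
  have [measurable]: "F t \<in> borel_measurable borel" for t
    using measurable_Pair2[OF F] by simp
  have [measurable]: "(\<lambda>t. F t x) \<in> borel_measurable borel" for x
    using measurable_Pair1[OF F] by simp
  have [measurable]: "(\<lambda>x. \<integral>\<^sup>+t. F t x \<partial>height x) \<in> borel_measurable borel"
    by (rule nn_integral_measurable_subprob_algebra2[OF F' height_kernel])
  have [measurable]: "(\<lambda>t. \<integral>\<^sup>+x. F t x \<partial>U t) \<in> borel_measurable borel"
    by (rule nn_integral_measurable_subprob_algebra2[OF F unif_kernel])
  have "(\<integral>\<^sup>+x. \<integral>\<^sup>+t. F t x \<partial>height x \<partial>\<pi>)
      = (\<integral>\<^sup>+x. (indicator K x * ennreal (\<rho> x) / Z) * (\<integral>\<^sup>+t. F t x \<partial>height x) \<partial>lborel)"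
    unfolding pi_meas_def by (subst nn_integral_density) auto
  also have "\<dots> = (\<integral>\<^sup>+x. (\<integral>\<^sup>+t. ?c t x \<partial>lborel) / Z \<partial>lborel)"
  proof (rule nn_integral_cong)
    fix x :: 'a
    consider "x \<notin> K" | "x \<in> K" "\<rho> x = 0" | "x \<in> K" "0 < \<rho> x" using \<rho>_nonneg[of x] by force
    then show "(indicator K x * ennreal (\<rho> x) / Z) * (\<integral>\<^sup>+t. F t x \<partial>height x) = (\<integral>\<^sup>+t. ?c t x \<partial>lborel) / Z"
    proof cases
      case 1
      then show ?thesis by (simp add: lvl_def)
    next
      \<comment> \<open>The section of the region above such a state is the single level 0, a null
        set.\<close>
      case 2
      have "AE t in lborel. t \<noteq> (0::real)" by (rule AE_lborel_singleton)
      then have "AE t in lborel. ?c t x = 0"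
        by eventually_elim (use 2 in \<open>auto simp: lvl_def indicator_def\<close>)
      then have "(\<integral>\<^sup>+t. ?c t x \<partial>lborel) = 0"
        by (subst nn_integral_cong_AE[of _ "\<lambda>_. 0"]) auto
      then show ?thesis using 2 by simp
    next
      case 3
      have "(\<integral>\<^sup>+t. F t x \<partial>height x) = (\<integral>\<^sup>+t. F t x * indicator {0..\<rho> x} t \<partial>lborel) / ennreal (\<rho> x)"
        using 3 by (simp add: height_def nn_integral_uniform_measure)
      moreover have "(\<integral>\<^sup>+t. F t x * indicator {0..\<rho> x} t \<partial>lborel) = (\<integral>\<^sup>+t. ?c t x \<partial>lborel)"
        by (rule nn_integral_cong) (use 3 in \<open>auto simp: lvl_def indicator_def\<close>)
      ultimately show ?thesis using 3 cancel[of "ennreal (\<rho> x)"] by simp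
    qed
  qed
  also have "\<dots> = (\<integral>\<^sup>+x. \<integral>\<^sup>+t. ?c t x \<partial>lborel \<partial>lborel) / Z"
    by (rule nn_integral_divide[OF c2])
  also have "\<dots> = (\<integral>\<^sup>+t. \<integral>\<^sup>+x. ?c t x \<partial>lborel \<partial>lborel) / Z"
    by (simp only: nn_integral_swap_lvl[OF F])
  also have "\<dots> = (\<integral>\<^sup>+t. (\<integral>\<^sup>+x. ?c t x \<partial>lborel) / Z \<partial>lborel)"
    by (rule nn_integral_divide[OF c1, symmetric])
  also have "\<dots> = (\<integral>\<^sup>+t. (indicator {0..} t * emeasure lborel (lvl K \<rho> t) / Z) * (\<integral>\<^sup>+x. F t x \<partial>U t) \<partial>lborel)"
  proof (rule nn_integral_cong_AE)
    have "AE t in lborel. t \<noteq> (0::real)" by (rule AE_lborel_singleton)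
    with AE_regular_or_empty
    show "AE t in lborel. (\<integral>\<^sup>+x. ?c t x \<partial>lborel) / Z
      = (indicator {0..} t * emeasure lborel (lvl K \<rho> t) / Z) * (\<integral>\<^sup>+x. F t x \<partial>U t)"
    proof eventually_elim
      case (elim t)
      consider "t < 0" | "0 < t" "lvl K \<rho> t = {}" | "regular t" using elim by linarith
      then show ?case
      proof cases
        case 3
        then have t: "0 < t" "emeasure lborel (lvl K \<rho> t) \<noteq> 0" "emeasure lborel (lvl K \<rho> t) \<noteq> \<top>"
          using vol[of t] by (auto simp: regular_def)
        have "(\<integral>\<^sup>+x. F t x \<partial>U t) = (\<integral>\<^sup>+x. F t x * indicator (lvl K \<rho> t) x \<partial>lborel) / emeasure lborel (lvl K \<rho> t)"
          by (simp add: unif_def nn_integral_uniform_measure)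
        then show ?thesis using t cancel[of "emeasure lborel (lvl K \<rho> t)"] by simp
      qed (simp_all)
    qed
  qed
  also have "\<dots> = (\<integral>\<^sup>+t. \<integral>\<^sup>+x. F t x \<partial>U t \<partial>\<L>)"
    unfolding ell_eq by (subst nn_integral_density) auto
  finally show ?thesis .
qed

text \<open>The signed version. One finiteness hypothesis serves both orders of integration, because
  the integral of the absolute value is exchanged as well.\<close>

lemma
  fixes F :: "real \<Rightarrow> 'a \<Rightarrow> real"
  assumes F[measurable]: "case_prod F \<in> borel_measurable (borel \<Otimes>\<^sub>M borel)"
    and fin: "(\<integral>\<^sup>+t. \<integral>\<^sup>+x. ennreal \<bar>F t x\<bar> \<partial>U t \<partial>\<L>) < \<infinity>"
  shows integrable_slice_integral: "integrable \<L> (\<lambda>t. \<integral>x. F t x \<partial>U t)"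
    and integral_slice_fubini: "(\<integral>x. \<integral>t. F t x \<partial>height x \<partial>\<pi>) = (\<integral>t. \<integral>x. F t x \<partial>U t \<partial>\<L>)"
proof -
  have F1: "case_prod F \<in> borel_measurable (\<L> \<Otimes>\<^sub>M borel)" by measurable
  have F2: "(\<lambda>(x, t). F t x) \<in> borel_measurable (\<pi> \<Otimes>\<^sub>M borel)" by measurable
  have k1: "U \<in> measurable \<L> (subprob_algebra borel)" "height \<in> measurable \<pi> (subprob_algebra borel)"
    by measurable
  show "integrable \<L> (\<lambda>t. \<integral>x. F t x \<partial>U t)"
    by (rule integrable_kernel_integral[OF F1 k1(1) fin])
  have sw: "(\<integral>\<^sup>+x. \<integral>\<^sup>+t. ennreal (F t x) \<partial>height x \<partial>\<pi>) = (\<integral>\<^sup>+t. \<integral>\<^sup>+x. ennreal (F t x) \<partial>U t \<partial>\<L>)"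
    "(\<integral>\<^sup>+x. \<integral>\<^sup>+t. ennreal (- F t x) \<partial>height x \<partial>\<pi>) = (\<integral>\<^sup>+t. \<integral>\<^sup>+x. ennreal (- F t x) \<partial>U t \<partial>\<L>)"
    "(\<integral>\<^sup>+x. \<integral>\<^sup>+t. ennreal \<bar>F t x\<bar> \<partial>height x \<partial>\<pi>) = (\<integral>\<^sup>+t. \<integral>\<^sup>+x. ennreal \<bar>F t x\<bar> \<partial>U t \<partial>\<L>)"
    by (rule nn_integral_slice_fubini; measurable)+
  show "(\<integral>x. \<integral>t. F t x \<partial>height x \<partial>\<pi>) = (\<integral>t. \<integral>x. F t x \<partial>U t \<partial>\<L>)"
    using integral_kernel_eq[OF F1 k1(1) fin] integral_kernel_eq[OF F2 k1(2)] fin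
    by (simp add: sw)
qed

end

section \<open>The hybrid sampler as a symmetric operator\<close>

text \<open>The kernel is a parameter so that the theory can be instantiated twice, with the given
  \<open>H\<close> and with the uniform distributions themselves.\<close>

locale slice_kernel = slice_density +
  fixes G :: "real \<Rightarrow> 'a \<Rightarrow> 'a measure"
  assumes G_meas: "(\<lambda>(t, x). G t x) \<in> borel \<Otimes>\<^sub>M borel \<rightarrow>\<^sub>M subprob_algebra borel"
    and G_prob: "\<And>t x. regular t \<Longrightarrow> x \<in> lvl K \<rho> t \<Longrightarrow> prob_space (G t x)"
    and G_rev: "\<And>t A B. regular t \<Longrightarrow> A \<in> sets borel \<Longrightarrow> B \<in> sets borel \<Longrightarrow>
               (\<integral>\<^sup>+x. indicator A x * emeasure (G t x) B \<partial>U t)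
             = (\<integral>\<^sup>+x. indicator B x * emeasure (G t x) A \<partial>U t)"
    and G_psd: "AE t in \<L>. psd_op (U t) (kop G t)"
begin

lemma kop_eq: "kop G t = (\<lambda>f x. \<integral>y. f y \<partial>G t x)"
  by (simp add: kop_def fun_eq_iff)

lemma reversible_kernel: "regular t \<Longrightarrow> reversible_kernel (U t) (G t)"
proof -
  assume t: "regular t"
  interpret prob_space "U t" using t by (rule prob_space_unif)
  show ?thesis
  proof
    show "G t \<in> U t \<rightarrow>\<^sub>M subprob_algebra (U t)"
      using measurable_Pair2[OF G_meas, of t] by (simp cong: measurable_cong_sets)
    show "AE x in U t. prob_space (G t x)"
      using AE_unif_lvl by eventually_elim (rule G_prob[OF t])
    show "\<integral>\<^sup>+ x. indicator A x * emeasure (G t x) B \<partial>U t = \<integral>\<^sup>+ x. indicator B x * emeasure (G t x) A \<partial>U t"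
      if "A \<in> events" "B \<in> events" for A B
      using G_rev[OF t, of A B] that by simp
  qed
qed

lemma measurable_kop:
  assumes F[measurable]: "case_prod F \<in> borel_measurable (borel \<Otimes>\<^sub>M borel)"
  shows "(\<lambda>(t, x). kop G t (F t) x) \<in> borel_measurable (borel \<Otimes>\<^sub>M borel)"
proof -
  have "(\<lambda>p. \<integral>y. F (fst p) y \<partial>(case_prod G p)) \<in> borel_measurable (borel \<Otimes>\<^sub>M borel)"
    by (rule integral_measurable_kernel[OF _ G_meas]) measurable
  then show ?thesis by (simp add: kop_eq split_beta')
qed

lemma measurable_kpow:
  assumes [measurable]: "f \<in> borel_measurable borel"
  shows "(\<lambda>(t, x). kpow G t k f x) \<in> borel_measurable (borel \<Otimes>\<^sub>M borel)"
proof (induction k)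
  case 0
  then show ?case by (simp add: kpow_def)
next
  case (Suc k)
  then show ?case
    using measurable_kop[of "\<lambda>t. kpow G t k f"] by (simp add: kpow_def)
qed

lemma kop_regular:
  assumes t: "regular t"
  shows sym_op_kop: "sym_op (U t) (kop G t)"
    and kop_contraction: "f \<in> L2space (U t) \<Longrightarrow> ip (U t) (kop G t f) (kop G t f) \<le> ip (U t) f f"
    and integral_kop: "f \<in> L2space (U t) \<Longrightarrow> (\<integral>x. kop G t f x \<partial>U t) = (\<integral>x. f x \<partial>U t)"
proof -
  interpret reversible_kernel "U t" "G t" using t by (rule reversible_kernel)
  show "sym_op (U t) (kop G t)"
    "f \<in> L2space (U t) \<Longrightarrow> ip (U t) (kop G t f) (kop G t f) \<le> ip (U t) f f"
    "f \<in> L2space (U t) \<Longrightarrow> (\<integral>x. kop G t f x \<partial>U t) = (\<integral>x. f x \<partial>U t)"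
    unfolding kop_eq by (rule sym_op_op op_contraction integral_op; assumption?)+
qed

lemma kpow_contraction:
  assumes t: "regular t" and f: "f \<in> L2space (U t)"
  shows "kpow G t k f \<in> L2space (U t) \<and> ip (U t) (kpow G t k f) (kpow G t k f) \<le> ip (U t) f f"
proof (induction k)
  case 0
  then show ?case using f by (simp add: kpow_def)
next
  case (Suc k)
  then show ?case
    using kop_contraction[OF t, of "kpow G t k f"] sym_opD(1)[OF sym_op_kop[OF t], of "kpow G t k f"]
    by (simp add: kpow_def)
qed

lemma hybrid_eq_height: "hybrid \<rho> G f x = (\<integral>t. kop G t f x \<partial>height x)" if f[measurable]: "f \<in> borel_measurable borel"
proof -
  have [measurable]: "(\<lambda>t. kop G t f x) \<in> borel_measurable borel"
    using measurable_Pair1[OF measurable_kop[of "\<lambda>t. f"], of x] by simp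
  consider "0 < \<rho> x" | "\<rho> x = 0" | "\<rho> x < 0" by linarith
  then show ?thesis
  proof cases
    case 1
    have "height x = density lborel (\<lambda>t. ennreal (indicator {0..\<rho> x} t / \<rho> x))"
      using 1 by (auto simp: height_def uniform_measure_def indicator_def divide_ennreal[symmetric]
          intro!: density_cong)
    then have "(\<integral>t. kop G t f x \<partial>height x) = (\<integral>t. (indicator {0..\<rho> x} t / \<rho> x) *\<^sub>R kop G t f x \<partial>lborel)"
      using 1 by (simp add: integral_density)
    also have "\<dots> = hybrid \<rho> G f x"
      by (simp add: hybrid_def set_lebesgue_integral_def)
    finally show ?thesis ..
  \<comment> \<open>For \<open>\<rho> x <= 0\<close> both sides are 0: on the left by division by
    zero or an empty interval, on the right by the null measure.\<close>
  qed (simp_all add: hybrid_def height_def set_lebesgue_integral_def)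
qed

lemma measurable_hybrid [measurable]:
  assumes f[measurable]: "f \<in> borel_measurable borel"
  shows "hybrid \<rho> G f \<in> borel_measurable borel"
proof -
  have m: "(\<lambda>(x, t). kop G t f x) \<in> borel_measurable (borel \<Otimes>\<^sub>M borel)"
    using measurable_pair_swap[OF measurable_kop[of "\<lambda>t. f"]] by (simp add: split_beta')
  show ?thesis
    using integral_measurable_kernel[OF m height_kernel] by (simp add: hybrid_eq_height[OF f, abs_def])
qed

end

context slice_density
begin

lemma nn_integral_height_const: "(\<integral>\<^sup>+x. \<integral>\<^sup>+t. g x \<partial>height x \<partial>\<pi>) = (\<integral>\<^sup>+x. g x \<partial>\<pi>)"
  by (rule nn_integral_cong_AE, use AE_pi in eventually_elim)
     (simp add: prob_space.emeasure_space_1[OF prob_space_height, simplified])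

lemma nn_integral_pi_slices:
  assumes [measurable]: "g \<in> borel_measurable borel"
  shows "(\<integral>\<^sup>+x. g x \<partial>\<pi>) = (\<integral>\<^sup>+t. \<integral>\<^sup>+x. g x \<partial>U t \<partial>\<L>)"
  using nn_integral_slice_fubini[of "\<lambda>t. g"] nn_integral_height_const[of g] by simp

lemma measurable_ip_unif [measurable]:
  assumes [measurable]: "case_prod F \<in> borel_measurable (borel \<Otimes>\<^sub>M borel)"
    "case_prod F' \<in> borel_measurable (borel \<Otimes>\<^sub>M borel)"
  shows "(\<lambda>t. ip (U t) (F t) (F' t)) \<in> borel_measurable borel"
  unfolding ip_def by (rule integral_measurable_kernel[OF _ unif_kernel]) measurable

lemma measurable_pi_iff: "f \<in> borel_measurable \<pi> \<longleftrightarrow> f \<in> borel_measurable borel"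
  by (simp cong: measurable_cong_sets)

lemma L2space_pi_slices:
  assumes f: "f \<in> L2space \<pi>"
  shows AE_L2space_unif: "AE t in \<L>. f \<in> L2space (U t)"
    and integrable_ip_unif: "integrable \<L> (\<lambda>t. ip (U t) f f)"
    and integral_ip_unif: "(\<integral>t. ip (U t) f f \<partial>\<L>) = ip \<pi> f f"
proof -
  have fm[measurable]: "f \<in> borel_measurable borel" using L2space_measurable[OF f] by (simp add: measurable_pi_iff)
  have eq: "(\<integral>\<^sup>+t. \<integral>\<^sup>+x. ennreal ((f x)\<^sup>2) \<partial>U t \<partial>\<L>) = ennreal (ip \<pi> f f)"
    using nn_integral_square_L2[OF f] nn_integral_pi_slices[of "\<lambda>x. ennreal ((f x)\<^sup>2)"] by simp
  have m[measurable]: "(\<lambda>t. \<integral>\<^sup>+x. ennreal ((f x)\<^sup>2) \<partial>U t) \<in> borel_measurable \<L>"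
    by (rule nn_integral_measurable_subprob_algebra2[where N=borel]) measurable
  have "AE t in \<L>. (\<integral>\<^sup>+x. ennreal ((f x)\<^sup>2) \<partial>U t) \<noteq> \<infinity>"
    by (rule nn_integral_noteq_infinite[OF m]) (simp add: eq)
  then show L: "AE t in \<L>. f \<in> L2space (U t)"
    by eventually_elim (auto simp: L2space_def less_top[symmetric])
  have ipm[measurable]: "(\<lambda>t. ip (U t) f f) \<in> borel_measurable \<L>"
    using measurable_ip_unif[of "\<lambda>t. f" "\<lambda>t. f"] by (simp cong: measurable_cong_sets)
  have "(\<integral>\<^sup>+t. ennreal (ip (U t) f f) \<partial>\<L>) = (\<integral>\<^sup>+t. \<integral>\<^sup>+x. ennreal ((f x)\<^sup>2) \<partial>U t \<partial>\<L>)"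
    by (rule nn_integral_cong_AE, use L in eventually_elim) (simp add: nn_integral_square_L2)
  with eq have e: "(\<integral>\<^sup>+t. ennreal (ip (U t) f f) \<partial>\<L>) = ennreal (ip \<pi> f f)" by simp
  show "integrable \<L> (\<lambda>t. ip (U t) f f)"
    by (rule integrableI_nonneg) (simp_all add: e ip_nonneg)
  show "(\<integral>t. ip (U t) f f \<partial>\<L>) = ip \<pi> f f"
    by (subst integral_eq_nn_integral) (simp_all add: e ip_nonneg)
qed

end

context slice_kernel
begin

text \<open>Jensen over the random level, exchange of the order of integration, and contraction on
  almost every slice.\<close>

lemma hybrid_contraction:
  assumes f: "f \<in> L2space \<pi>"
  shows "hybrid \<rho> G f \<in> L2space \<pi>" "ip \<pi> (hybrid \<rho> G f) (hybrid \<rho> G f) \<le> ip \<pi> f f"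
proof -
  have fm[measurable]: "f \<in> borel_measurable borel" using L2space_measurable[OF f] by (simp add: measurable_pi_iff)
  have k[measurable]: "(\<lambda>(t, x). kop G t f x) \<in> borel_measurable (borel \<Otimes>\<^sub>M borel)"
    by (rule measurable_kop) measurable
  have kx[measurable]: "(\<lambda>t. kop G t f x) \<in> borel_measurable borel" for x
    using measurable_Pair1[OF k, of x] by simp
  have "(\<integral>\<^sup>+x. ennreal ((hybrid \<rho> G f x)\<^sup>2) \<partial>\<pi>) \<le> (\<integral>\<^sup>+x. \<integral>\<^sup>+t. ennreal ((kop G t f x)\<^sup>2) \<partial>height x \<partial>\<pi>)"
    by (rule nn_integral_mono_AE, use AE_pi in eventually_elim)
       (auto simp: hybrid_eq_height intro!: prob_space_square_integral_le prob_space_height kx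
          cong: measurable_cong_sets)
  also have "\<dots> = (\<integral>\<^sup>+t. \<integral>\<^sup>+x. ennreal ((kop G t f x)\<^sup>2) \<partial>U t \<partial>\<L>)"
    by (rule nn_integral_slice_fubini) measurable
  also have "\<dots> \<le> (\<integral>\<^sup>+t. \<integral>\<^sup>+x. ennreal ((f x)\<^sup>2) \<partial>U t \<partial>\<L>)"
    by (rule nn_integral_mono_AE, use AE_L2space_unif[OF f] AE_ell_regular in eventually_elim)
       (simp add: nn_integral_square_L2 sym_opD(1)[OF sym_op_kop] ennreal_leI kop_contraction)
  also have "\<dots> = ennreal (ip \<pi> f f)"
    using nn_integral_square_L2[OF f] nn_integral_pi_slices[of "\<lambda>x. ennreal ((f x)\<^sup>2)"] by simp
  finally have le: "(\<integral>\<^sup>+x. ennreal ((hybrid \<rho> G f x)\<^sup>2) \<partial>\<pi>) \<le> ennreal (ip \<pi> f f)" .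
  show L: "hybrid \<rho> G f \<in> L2space \<pi>"
    by (rule L2spaceI[OF _ le]) (simp add: measurable_pi_iff)
  show "ip \<pi> (hybrid \<rho> G f) (hybrid \<rho> G f) \<le> ip \<pi> f f"
    using le L by (simp add: ip_le_iff_nn_integral ip_nonneg)
qed

text \<open>\<open>hybrid\<close> averages over \<open>height x\<close>, so the signed exchange
  applies once the integrand is absolutely integrable. On each slice its absolute integral is at
  most \<open>ip (U t) f f + ip (U t) g g\<close> by contraction.\<close>

lemma
  assumes f: "f \<in> L2space \<pi>" and g: "g \<in> L2space \<pi>"
  shows integrable_ip_kop: "integrable \<L> (\<lambda>t. ip (U t) (kop G t f) g)"
    and ip_hybrid: "ip \<pi> (hybrid \<rho> G f) g = (\<integral>t. ip (U t) (kop G t f) g \<partial>\<L>)"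
proof -
  have fm[measurable]: "f \<in> borel_measurable borel" "g \<in> borel_measurable borel"
    using f g by (simp_all add: L2space_measurable flip: measurable_pi_iff)
  have k[measurable]: "(\<lambda>(t, x). kop G t f x) \<in> borel_measurable (borel \<Otimes>\<^sub>M borel)"
    by (rule measurable_kop) measurable
  let ?F = "\<lambda>t x. kop G t f x * g x"
  have F: "case_prod ?F \<in> borel_measurable (borel \<Otimes>\<^sub>M borel)" by measurable
  have "(\<integral>\<^sup>+t. \<integral>\<^sup>+x. ennreal \<bar>?F t x\<bar> \<partial>U t \<partial>\<L>) \<le> (\<integral>\<^sup>+t. ennreal (ip (U t) f f + ip (U t) g g) \<partial>\<L>)"
  proof (rule nn_integral_mono_AE, use AE_L2space_unif[OF f] AE_L2space_unif[OF g] AE_ell_regular in eventually_elim)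
    case (elim t)
    have kL: "kop G t f \<in> L2space (U t)" using elim sym_opD(1)[OF sym_op_kop] by blast
    have "(\<integral>\<^sup>+x. ennreal \<bar>?F t x\<bar> \<partial>U t) \<le> (\<integral>\<^sup>+x. ennreal ((kop G t f x)\<^sup>2) + ennreal ((g x)\<^sup>2) \<partial>U t)"
      by (intro nn_integral_mono) (simp add: abs_mult_le_sum_squares flip: ennreal_plus)
    also have "\<dots> = ennreal (ip (U t) (kop G t f) (kop G t f)) + ennreal (ip (U t) g g)"
      using kL elim by (subst nn_integral_add) (auto simp: nn_integral_square_L2 dest: L2space_measurable)
    also have "\<dots> \<le> ennreal (ip (U t) f f + ip (U t) g g)"
      using kop_contraction elim by (simp add: ip_nonneg flip: ennreal_plus)
    finally show ?case .
  qed
  also have "\<dots> = ennreal (ip \<pi> f f + ip \<pi> g g)"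
    using integrable_ip_unif[OF f] integrable_ip_unif[OF g]
    by (subst nn_integral_eq_integral) (auto simp: integral_ip_unif f g ip_nonneg intro!: AE_I2 add_nonneg_nonneg)
  also have "\<dots> < \<infinity>" by simp
  finally have fin: "(\<integral>\<^sup>+t. \<integral>\<^sup>+x. ennreal \<bar>?F t x\<bar> \<partial>U t \<partial>\<L>) < \<infinity>" .
  show "integrable \<L> (\<lambda>t. ip (U t) (kop G t f) g)"
    unfolding ip_def by (rule integrable_slice_integral[OF F fin])
  show "ip \<pi> (hybrid \<rho> G f) g = (\<integral>t. ip (U t) (kop G t f) g \<partial>\<L>)"
    using integral_slice_fubini[OF F fin] by (simp add: ip_def hybrid_eq_height)
qed

lemma sym_op_hybrid: "sym_op \<pi> (hybrid \<rho> G)"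
  unfolding sym_op_def
proof (intro conjI ballI)
  fix f assume f: "f \<in> L2space \<pi>"
  show "hybrid \<rho> G f \<in> L2space \<pi>" by (rule hybrid_contraction[OF f])
  fix g assume g: "g \<in> L2space \<pi>"
  have "ip \<pi> (hybrid \<rho> G f) g = (\<integral>t. ip (U t) (kop G t f) g \<partial>\<L>)" by (rule ip_hybrid[OF f g])
  also have "\<dots> = (\<integral>t. ip (U t) (kop G t g) f \<partial>\<L>)"
  proof (rule integral_cong_AE)
    show "AE t in \<L>. ip (U t) (kop G t f) g = ip (U t) (kop G t g) f"
      using AE_L2space_unif[OF f] AE_L2space_unif[OF g] AE_ell_regular
      by eventually_elim (metis sym_opD(2)[OF sym_op_kop] ip_commute)
  qed (use integrable_ip_kop[OF f g] integrable_ip_kop[OF g f] in auto)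
  also have "\<dots> = ip \<pi> (hybrid \<rho> G g) f" by (rule ip_hybrid[OF g f, symmetric])
  finally show "ip \<pi> (hybrid \<rho> G f) g = ip \<pi> f (hybrid \<rho> G g)" by (simp add: ip_commute)
qed

lemma psd_op_hybrid: "psd_op \<pi> (hybrid \<rho> G)"
  unfolding psd_op_def
proof
  fix f assume f: "f \<in> L2space \<pi>"
  have "AE t in \<L>. 0 \<le> ip (U t) (kop G t f) f"
    using AE_L2space_unif[OF f] G_psd by eventually_elim (simp add: psd_op_def)
  then show "0 \<le> ip \<pi> (hybrid \<rho> G f) f"
    unfolding ip_hybrid[OF f f] by (rule integral_nonneg_AE)
qed

end

section \<open>Comparison of the spectral gaps\<close>

text \<open>Positivity is tested at \<open>f\<close> minus its mean; preservation of means removes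
  one cross term and evaluates the other. Used on slices to compare \<open>U_t\<close> with
  \<open>H_t\<close>, and on \<pi> to see that subtracting \<open>S\<close> keeps the form
  nonnegative.\<close>

lemma (in prob_space) mean_square_le_quadratic_form:
  assumes A: "sym_op M A" "psd_op M A"
    and mean: "\<And>f. f \<in> L2space M \<Longrightarrow> (\<integral>x. A f x \<partial>M) = (\<integral>x. f x \<partial>M)"
    and f: "f \<in> L2space M"
  shows "(\<integral>x. f x \<partial>M)\<^sup>2 \<le> ip M (A f) f"
proof -
  define c where "c = (\<integral>x. f x \<partial>M)"
  define g where "g = (\<lambda>x. f x - c)"
  have const: "(\<lambda>x. d) \<in> L2space M" for d by (rule L2space_const) unfold_locales
  have ip_const: "ip M h (\<lambda>x. c) = c * (\<integral>x. h x \<partial>M)" for h by (simp add: ip_def mult.commute)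
  have g: "g \<in> L2space M" unfolding g_def by (rule L2space_diff[OF f const])
  have int: "integrable M f" using integrable_L2_mult[OF f const[of 1]] by simp
  have g0: "(\<integral>x. g x \<partial>M) = 0" using int by (simp add: g_def c_def prob_space)
  have Ag: "A g \<in> L2space M" "A f \<in> L2space M" using sym_opD(1)[OF A(1)] f g by auto
  have "0 \<le> ip M (A g) g" using A(2) g by (simp add: psd_op_def)
  also have "\<dots> = ip M (A g) f - ip M (A g) (\<lambda>x. c)"
    using ip_diff_right[OF f const[of c] Ag(1)] unfolding g_def by simp
  also have "\<dots> = ip M g (A f)" using sym_opD(2)[OF A(1) g f] mean[OF g] g0 by (simp add: ip_const)
  also have "\<dots> = ip M (A f) f - ip M (A f) (\<lambda>x. c)"
    using ip_diff_left[OF f const[of c] Ag(2)] unfolding g_def by (simp add: ip_commute)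
  also have "ip M (A f) (\<lambda>x. c) = c\<^sup>2" by (simp add: ip_const mean[OF f] power2_eq_square) (simp add: c_def)
  finally show ?thesis by (simp add: c_def)
qed

text \<open>The variance is at most the second moment. Since \<open>hybrid\<close> and
  \<open>kpow\<close> preserve means, subtracting the mean of the input from their output does not
  enlarge the norm.\<close>

lemma (in prob_space) ip_diff_mean_le:
  assumes h: "h \<in> L2space M" and c: "c = (\<integral>x. h x \<partial>M)"
  shows "(\<lambda>x. h x - c) \<in> L2space M" "ip M (\<lambda>x. h x - c) (\<lambda>x. h x - c) \<le> ip M h h"
proof -
  have const: "(\<lambda>x. d) \<in> L2space M" for d by (rule L2space_const) unfold_locales
  show d: "(\<lambda>x. h x - c) \<in> L2space M" by (rule L2space_diff[OF h const])
  have "ip M (\<lambda>x. h x - c) (\<lambda>x. h x - c) = ip M h h - c * (\<integral>x. h x \<partial>M) - (c * (\<integral>x. h x \<partial>M) - c * c)"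
    unfolding ip_diff_right[OF h const d] ip_diff_left[OF h const h] ip_diff_left[OF h const const]
    by (simp add: ip_def prob_space mult.commute)
  also have "\<dots> = ip M h h - c\<^sup>2" by (simp add: c[symmetric] power2_eq_square)
  finally show "ip M (\<lambda>x. h x - c) (\<lambda>x. h x - c) \<le> ip M h h" by simp
qed

lemma kop_cmult: "kop G t (\<lambda>x. c * f x) = (\<lambda>x. c * kop G t f x)"
  by (simp add: kop_def fun_eq_iff)

lemma kpow_cmult: "kpow G t k (\<lambda>x. c * f x) = (\<lambda>x. c * kpow G t k f x)"
  by (induction k) (simp_all add: kpow_def kop_cmult)

lemma hybrid_cmult: "hybrid \<rho> G (\<lambda>x. c * f x) = (\<lambda>x. c * hybrid \<rho> G f x)"
  by (simp add: hybrid_def kop_cmult fun_eq_iff)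

lemma simple_slice_eq_hybrid: "simple_slice K \<rho> = hybrid \<rho> (\<lambda>t x. unif K \<rho> t)"
  by (simp add: simple_slice_def hybrid_def kop_def fun_eq_iff)

section \<open>The samplers minus the mean\<close>

context slice_kernel
begin

definition centered :: "('a \<Rightarrow> real) \<Rightarrow> 'a \<Rightarrow> real" where
  "centered f x = hybrid \<rho> G f x - (\<integral>y. f y \<partial>\<pi>)"

lemma gap_hybrid: "gap \<pi> (hybrid \<rho> G) = 1 - opnorm \<pi> centered"
  by (simp add: gap_def centered_def[abs_def])

lemma regularI: "x \<in> K \<Longrightarrow> 0 < t \<Longrightarrow> t < \<rho> x \<Longrightarrow> regular t"
  unfolding regular_def rho_sup_def by (auto simp: less_SUP_iff)

text \<open>Both endpoints are dropped: 0 is not regular, and \<open>\<rho> x\<close> may attain the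
  supremum. For a state in \<open>K\<close>, the levels strictly between are regular.\<close>

lemma AE_lborel_height: "AE t in lborel. t \<in> {0..\<rho> x} \<longrightarrow> 0 < t \<and> t < \<rho> x"
proof -
  have "AE t in lborel. t \<noteq> 0" "AE t in lborel. t \<noteq> \<rho> x" by (rule AE_lborel_singleton)+
  then show ?thesis by eventually_elim auto
qed

lemma hybrid_one: "AE x in \<pi>. hybrid \<rho> G (\<lambda>_. 1) x = 1"
  using AE_pi
proof eventually_elim
  case (elim x)
  interpret prob_space "height x" using elim by (intro prob_space_height) simp
  have [measurable]: "(\<lambda>t. kop G t (\<lambda>_. 1) x) \<in> borel_measurable borel"
    using measurable_Pair1[OF measurable_kop[of "\<lambda>t x. 1"], of x] by simp
  have "AE t in height x. kop G t (\<lambda>_. 1) x = 1"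
  proof -
    have "AE t in height x. 0 < t \<and> t < \<rho> x"
      using AE_lborel_height[of x] elim unfolding height_def by (simp only: if_True AE_uniform_measureI borel_closed sets_lborel closed_atLeastAtMost)
    then show ?thesis
    proof eventually_elim
      case (elim t)
      then have "prob_space (G t x)"
        using \<open>x \<in> K \<and> 0 < \<rho> x\<close> by (intro G_prob) (auto intro: regularI simp: lvl_def)
      then show ?case by (simp add: kop_def prob_space.prob_space)
    qed
  qed
  then have "(\<integral>t. kop G t (\<lambda>_. 1) x \<partial>height x) = (\<integral>t. 1 \<partial>height x)"
    by (intro integral_cong_AE) (simp_all cong: measurable_cong_sets)
  then show ?case using prob_space by (simp add: hybrid_eq_height)
qed

lemma integral_hybrid:
  assumes f: "f \<in> L2space \<pi>"
  shows "(\<integral>x. hybrid \<rho> G f x \<partial>\<pi>) = (\<integral>x. f x \<partial>\<pi>)"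
proof -
  interpret prob_space \<pi> by (rule prob_space_pi)
  have one: "(\<lambda>x. 1) \<in> L2space \<pi>" by (rule L2space_const) unfold_locales
  have [measurable]: "f \<in> borel_measurable borel" using L2space_measurable[OF f] by (simp add: measurable_pi_iff)
  have "ip \<pi> (hybrid \<rho> G f) (\<lambda>x. 1) = ip \<pi> f (hybrid \<rho> G (\<lambda>x. 1))"
    by (rule sym_opD(2)[OF sym_op_hybrid f one])
  also have "\<dots> = (\<integral>x. f x \<partial>\<pi>)"
    unfolding ip_def
    by (rule integral_cong_AE, measurable, use hybrid_one in eventually_elim) simp
  finally show ?thesis by (simp add: ip_def)
qed

lemma centered_L2:
  assumes f: "f \<in> L2space \<pi>"
  shows "centered f \<in> L2space \<pi>" "ip \<pi> (centered f) (centered f) \<le> 1 * ip \<pi> f f"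
proof -
  interpret prob_space \<pi> by (rule prob_space_pi)
  note * = ip_diff_mean_le[OF hybrid_contraction(1)[OF f] integral_hybrid[OF f, symmetric]]
  show "centered f \<in> L2space \<pi>" unfolding centered_def[abs_def] by (rule *)
  show "ip \<pi> (centered f) (centered f) \<le> 1 * ip \<pi> f f"
    unfolding centered_def[abs_def] using *(2) hybrid_contraction(2)[OF f] by simp
qed

lemma ip_centered:
  assumes f: "f \<in> L2space \<pi>" and g: "g \<in> L2space \<pi>"
  shows "ip \<pi> (centered f) g = ip \<pi> (hybrid \<rho> G f) g - (\<integral>x. f x \<partial>\<pi>) * (\<integral>x. g x \<partial>\<pi>)"
proof -
  interpret prob_space \<pi> by (rule prob_space_pi)
  have const: "(\<lambda>x. d) \<in> L2space \<pi>" for d by (rule L2space_const) unfold_locales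
  show ?thesis
    unfolding centered_def[abs_def]
    using ip_diff_left[OF hybrid_contraction(1)[OF f] const g] by (simp add: ip_def)
qed

lemma sym_op_centered: "sym_op \<pi> centered"
  unfolding sym_op_def
proof (intro conjI ballI)
  fix f g assume f: "f \<in> L2space \<pi>" and g: "g \<in> L2space \<pi>"
  show "ip \<pi> (centered f) g = ip \<pi> f (centered g)"
    using sym_opD(2)[OF sym_op_hybrid f g] ip_centered[OF f g] ip_centered[OF g f]
    by (simp add: ip_commute)
qed (rule centered_L2)

lemma psd_op_centered: "psd_op \<pi> centered"
  unfolding psd_op_def
proof
  fix f assume f: "f \<in> L2space \<pi>"
  interpret prob_space \<pi> by (rule prob_space_pi)
  show "0 \<le> ip \<pi> (centered f) f"
    using mean_square_le_quadratic_form[OF sym_op_hybrid psd_op_hybrid integral_hybrid f]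
    by (simp add: ip_centered[OF f f] power2_eq_square)
qed

lemma centered_cmult: "centered (\<lambda>x. c * f x) = (\<lambda>x. c * centered f x)"
  by (simp add: centered_def[abs_def] hybrid_cmult right_diff_distrib)

lemma quadratic_form_centered_le:
  "f \<in> L2space \<pi> \<Longrightarrow> ip \<pi> (centered f) f \<le> opnorm \<pi> centered * ip \<pi> f f"
  by (rule quadratic_form_le_opnorm[OF centered_cmult centered_L2])

end

text \<open>The form of this kernel on a slice is the square of \<open>U_t(f)\<close>, hence
  nonnegative, and reversibility is commutativity of a product of two masses. The prefix
  \<open>simple\<close> now provides every sampler lemma for \<open>U\<close>.\<close>

sublocale slice_density \<subseteq> simple: slice_kernel K \<rho> "\<lambda>t x. unif K \<rho> t"
proof (intro slice_kernel.intro slice_kernel_axioms.intro slice_density_axioms)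
  show "(\<lambda>(t, x). U t) \<in> borel \<Otimes>\<^sub>M borel \<rightarrow>\<^sub>M subprob_algebra borel"
    unfolding split_beta' by measurable
  show "prob_space (U t)" if "regular t" "x \<in> lvl K \<rho> t" for t x
    using that(1) by (rule prob_space_unif)
  show "\<integral>\<^sup>+ x. indicator A x * emeasure (U t) B \<partial>U t = \<integral>\<^sup>+ x. indicator B x * emeasure (U t) A \<partial>U t"
    if "regular t" "A \<in> sets borel" "B \<in> sets borel" for t A B
    using that(2,3) by (simp add: nn_integral_multc mult.commute)
  show "AE t in \<L>. psd_op (U t) (kop (\<lambda>t x. U t) t)"
    by (rule AE_I2) (simp add: psd_op_def ip_def kop_def)
qed

section \<open>Upper bound\<close>

context slice_kernel
begin

lemma simple_le_hybrid:
  assumes f: "f \<in> L2space \<pi>"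
  shows "ip \<pi> (hybrid \<rho> (\<lambda>t x. U t) f) f \<le> ip \<pi> (hybrid \<rho> G f) f"
  unfolding ip_hybrid[OF f f] simple.ip_hybrid[OF f f]
proof (rule integral_mono_AE)
  show "AE t in \<L>. ip (U t) (kop (\<lambda>t x. U t) t f) f \<le> ip (U t) (kop G t f) f"
    using AE_L2space_unif[OF f] AE_ell_regular G_psd
  proof eventually_elim
    case (elim t)
    interpret prob_space "U t" using elim by (intro prob_space_unif)
    show ?case
      using mean_square_le_quadratic_form[OF sym_op_kop[OF elim(2)] elim(3) integral_kop[OF elim(2)] elim(1)]
      by (simp add: ip_def kop_def power2_eq_square)
  qed
qed (use integrable_ip_kop[OF f f] simple.integrable_ip_kop[OF f f] in auto)

lemma gap_hybrid_le_gap_simple: "gap \<pi> (hybrid \<rho> G) \<le> gap \<pi> (simple_slice K \<rho>)"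
proof -
  have "opnorm \<pi> simple.centered \<le> opnorm \<pi> centered"
  proof (rule opnorm_le_quadratic_form[OF simple.sym_op_centered simple.psd_op_centered opnorm_nonneg])
    fix f assume f: "f \<in> L2space \<pi>"
    have "ip \<pi> (simple.centered f) f \<le> ip \<pi> (centered f) f"
      using simple_le_hybrid[OF f] by (simp add: ip_centered[OF f f] simple.ip_centered[OF f f])
    also have "\<dots> \<le> opnorm \<pi> centered * ip \<pi> f f" by (rule quadratic_form_centered_le[OF f])
    finally show "ip \<pi> (simple.centered f) f \<le> opnorm \<pi> centered * ip \<pi> f f" .
  qed
  then show ?thesis by (simp add: gap_hybrid simple_slice_eq_hybrid simple.gap_hybrid)
qed

section \<open>The deviations of \<open>H_t^k\<close> from \<open>U_t\<close> and the constants
  \<beta>\<close>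

definition dev :: "nat \<Rightarrow> real \<Rightarrow> ('a \<Rightarrow> real) \<Rightarrow> 'a \<Rightarrow> real" where
  "dev k t f x = kpow G t k f x - (\<integral>z. f z \<partial>U t)"

lemma integral_kpow:
  assumes t: "regular t" and f: "f \<in> L2space (U t)"
  shows "(\<integral>x. kpow G t k f x \<partial>U t) = (\<integral>x. f x \<partial>U t)"
proof (induction k)
  case (Suc k)
  then show ?case
    using integral_kop[OF t, of "kpow G t k f"] kpow_contraction[OF t f, of k] by (simp add: kpow_def)
qed (simp add: kpow_def)

lemma dev_L2:
  assumes t: "regular t" and f: "f \<in> L2space (U t)"
  shows "dev k t f \<in> L2space (U t)" "ip (U t) (dev k t f) (dev k t f) \<le> 1 * ip (U t) f f"
proof -
  interpret prob_space "U t" using t by (rule prob_space_unif)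
  note kp = kpow_contraction[OF t f, of k]
  note * = ip_diff_mean_le[OF conjunct1[OF kp] integral_kpow[OF t f, symmetric]]
  show "dev k t f \<in> L2space (U t)" unfolding dev_def[abs_def] by (rule *)
  show "ip (U t) (dev k t f) (dev k t f) \<le> 1 * ip (U t) f f"
    unfolding dev_def[abs_def] using *(2) kp by simp
qed

lemma ip_dev_le_opnorm:
  assumes t: "regular t" and f: "f \<in> L2space (U t)"
  shows "ip (U t) (dev k t f) (dev k t f) \<le> (opnorm (U t) (dev k t))\<^sup>2 * ip (U t) f f"
  by (rule ip_le_opnorm[OF _ dev_L2[OF t] f])
     (simp add: dev_def[abs_def] kpow_cmult right_diff_distrib)

lemma opnorm_dev_le: "regular t \<Longrightarrow> opnorm (U t) (dev k t) \<le> 1"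
proof (rule opnorm_le)
  fix f assume t: "regular t" and "f \<in> L2ball (U t)"
  then have f: "f \<in> L2space (U t)" "ip (U t) f f \<le> 1" by (auto simp: L2ball_iff)
  then show "(\<integral>\<^sup>+x. ennreal ((dev k t f x)\<^sup>2) \<partial>U t) \<le> ennreal (1\<^sup>2)"
    using dev_L2[OF t f(1), of k] by (simp add: nn_integral_square_L2)
qed simp

lemma beta_eq: "beta K \<rho> G k = (SUP x\<in>K. sqrt (enn2real (\<integral>\<^sup>+t\<in>{0..\<rho> x}.
    ennreal ((opnorm (U t) (dev k t))\<^sup>2) \<partial>lborel) / \<rho> x))"
  by (simp add: beta_def dev_def[abs_def])

text \<open>This guards against default values in \<open>beta\<close>: the integral is finite, so
  \<open>enn2real\<close> loses nothing, and the quotients by \<open>\<rho> x\<close> are bounded by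
  1, so the real supremum is genuine.\<close>

lemma nn_integral_opnorm_dev_le:
  assumes x: "x \<in> K"
  shows "(\<integral>\<^sup>+t\<in>{0..\<rho> x}. ennreal ((opnorm (U t) (dev k t))\<^sup>2) \<partial>lborel) \<le> ennreal (\<rho> x)"
proof -
  have "(\<integral>\<^sup>+t\<in>{0..\<rho> x}. ennreal ((opnorm (U t) (dev k t))\<^sup>2) \<partial>lborel) \<le> (\<integral>\<^sup>+t. indicator {0..\<rho> x} t \<partial>lborel)"
  proof (rule nn_integral_mono_AE, use AE_lborel_height[of x] in eventually_elim)
    case (elim t)
    then show ?case
      using opnorm_dev_le[of t k] regularI[OF x, of t] opnorm_nonneg[of "U t" "dev k t"]
      by (auto simp: indicator_def abs_square_le_1)
  qed
  also have "\<dots> = ennreal (\<rho> x)" using \<rho>_nonneg[OF x] by simp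
  finally show ?thesis .
qed

lemma
  shows beta_nonneg: "0 \<le> beta K \<rho> G k"
    and nn_integral_opnorm_dev_le_beta: "x \<in> K \<Longrightarrow>
      (\<integral>\<^sup>+t\<in>{0..\<rho> x}. ennreal ((opnorm (U t) (dev k t))\<^sup>2) \<partial>lborel) \<le> ennreal ((beta K \<rho> G k)\<^sup>2 * \<rho> x)"
proof -
  let ?I = "\<lambda>x. \<integral>\<^sup>+t\<in>{0..\<rho> x}. ennreal ((opnorm (U t) (dev k t))\<^sup>2) \<partial>lborel"
  have fin: "?I x = ennreal (enn2real (?I x))" if "x \<in> K" for x
    using le_less_trans[OF nn_integral_opnorm_dev_le[OF that, of k], of \<top>] by simp
  have le1: "enn2real (?I x) \<le> \<rho> x" if "x \<in> K" for x
    using nn_integral_opnorm_dev_le[OF that, of k] \<rho>_nonneg[OF that] by (intro enn2real_leI) auto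
  have bdd: "bdd_above ((\<lambda>x. sqrt (enn2real (?I x) / \<rho> x)) ` K)"
  proof (rule bdd_aboveI2)
    fix x assume "x \<in> K"
    then show "sqrt (enn2real (?I x) / \<rho> x) \<le> 1"
      using le1[of x] \<rho>_nonneg[of x] by (cases "\<rho> x = 0") (auto simp: divide_le_eq_1)
  qed
  have le: "sqrt (enn2real (?I x) / \<rho> x) \<le> beta K \<rho> G k" if "x \<in> K" for x
    unfolding beta_eq by (rule cSUP_upper[OF that bdd])
  \<comment> \<open>Nonnegativity of the supremum needs a member, and positive mass provides
    one.\<close>
  have "K \<noteq> {}" using int_pos by auto
  then obtain x where x: "x \<in> K" by auto
  have "0 \<le> sqrt (enn2real (?I x) / \<rho> x)" using \<rho>_nonneg[OF x] by simp
  also note le[OF x]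
  finally show nn: "0 \<le> beta K \<rho> G k" .
  show "?I x \<le> ennreal ((beta K \<rho> G k)\<^sup>2 * \<rho> x)" if x: "x \<in> K" for x
  proof (cases "\<rho> x = 0")
    case True
    then show ?thesis using nn_integral_opnorm_dev_le[OF x, of k] by simp
  next
    case False
    then have pos: "0 < \<rho> x" using \<rho>_nonneg[OF x] by simp
    have "enn2real (?I x) / \<rho> x \<le> (beta K \<rho> G k)\<^sup>2"
      using le[OF x] by (rule sqrt_le_D)
    then have "enn2real (?I x) \<le> (beta K \<rho> G k)\<^sup>2 * \<rho> x" using pos by (simp add: field_simps)
    then show ?thesis by (subst fin[OF x]) (rule ennreal_leI)
  qed
qed

lemma measurable_dev:
  assumes [measurable]: "f \<in> borel_measurable borel"
  shows "(\<lambda>(t, x). dev k t f x) \<in> borel_measurable (borel \<Otimes>\<^sub>M borel)"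
proof -
  note [measurable] = measurable_kpow[of f k]
  have [measurable]: "(\<lambda>t. \<integral>z. f z \<partial>U t) \<in> borel_measurable borel"
    by (rule integral_measurable_kernel[OF _ unif_kernel]) measurable
  show ?thesis unfolding dev_def by measurable
qed

text \<open>\<open>beta\<close> bounds an average over the levels below each single state, while the
  integral on the left runs over \<open>ell\<close>. Writing the integrand as a level weight times
  the slice integral of \<open>f^2\<close> and exchanging the order puts the level average inside,
  at a fixed state.\<close>

lemma
  assumes f: "f \<in> L2space \<pi>"
  shows integrable_ip_dev: "integrable \<L> (\<lambda>t. ip (U t) (dev k t f) (dev k t f))"
    and integral_ip_dev_le: "(\<integral>t. ip (U t) (dev k t f) (dev k t f) \<partial>\<L>) \<le> (beta K \<rho> G k)\<^sup>2 * ip \<pi> f f"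
proof -
  have [measurable]: "f \<in> borel_measurable borel" using L2space_measurable[OF f] by (simp add: measurable_pi_iff)
  define N where "N t = ip (U t) (dev k t f) (dev k t f)" for t
  define n where "n t = ip (U t) f f" for t
  \<comment> \<open>\<open>t \<mapsto> opnorm (U t) (dev k t)\<close> may fail to be measurable; the Rayleigh quotient \<open>q\<close>
    of the fixed function \<open>f\<close> is measurable, lies below its square, and is all that is needed.\<close>
  define q where "q t = N t / n t" for t
  note [measurable] = measurable_dev[of f k]
  have [measurable]: "N \<in> borel_measurable borel" "n \<in> borel_measurable borel"
    unfolding N_def n_def by measurable
  then have [measurable]: "q \<in> borel_measurable borel" unfolding q_def by measurable
  have N0: "0 \<le> N t" and n0: "0 \<le> n t" and q0: "0 \<le> q t" for t
    by (simp_all add: N_def n_def q_def ip_nonneg)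
  have Nn: "AE t in \<L>. N t \<le> n t \<and> f \<in> L2space (U t)"
    using AE_L2space_unif[OF f] AE_ell_regular
    by eventually_elim (use dev_L2 in \<open>simp add: N_def n_def\<close>)
  show int: "integrable \<L> (\<lambda>t. ip (U t) (dev k t f) (dev k t f))"
    unfolding N_def[symmetric]
    by (rule Bochner_Integration.integrable_bound[OF integrable_ip_unif[OF f]], measurable,
        use Nn in eventually_elim) (use N0 in \<open>simp add: n_def[symmetric] n0\<close>)
  have "AE t in \<L>. q t \<le> (opnorm (U t) (dev k t))\<^sup>2"
    using AE_L2space_unif[OF f] AE_ell_regular
  proof eventually_elim
    case (elim t)
    have "N t \<le> (opnorm (U t) (dev k t))\<^sup>2 * n t"
      unfolding N_def n_def using elim by (intro ip_dev_le_opnorm)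
    then show ?case using n0[of t] by (cases "n t = 0") (auto simp: q_def field_simps)
  qed
  then have qle: "AE t in lborel. regular t \<longrightarrow> q t \<le> (opnorm (U t) (dev k t))\<^sup>2"
    by (simp add: AE_ell_iff)
  have height_q: "(\<integral>\<^sup>+t. ennreal (q t) \<partial>height x) \<le> ennreal ((beta K \<rho> G k)\<^sup>2)" if x: "x \<in> K" "0 < \<rho> x" for x
  proof -
    have "(\<integral>\<^sup>+t. ennreal (q t) \<partial>height x) = (\<integral>\<^sup>+t\<in>{0..\<rho> x}. ennreal (q t) \<partial>lborel) / ennreal (\<rho> x)"
      using x by (simp add: height_def nn_integral_uniform_measure)
    also have "\<dots> \<le> (\<integral>\<^sup>+t\<in>{0..\<rho> x}. ennreal ((opnorm (U t) (dev k t))\<^sup>2) \<partial>lborel) / ennreal (\<rho> x)"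
    proof (intro divide_right_mono_ennreal nn_integral_mono_AE)
      show "AE t in lborel. ennreal (q t) * indicator {0..\<rho> x} t
          \<le> ennreal ((opnorm (U t) (dev k t))\<^sup>2) * indicator {0..\<rho> x} t"
        using qle AE_lborel_height[of x]
        by eventually_elim (use regularI[OF x(1)] in \<open>auto simp: indicator_def intro!: ennreal_leI\<close>)
    qed
    also have "\<dots> \<le> ennreal ((beta K \<rho> G k)\<^sup>2 * \<rho> x) / ennreal (\<rho> x)"
      by (intro divide_right_mono_ennreal nn_integral_opnorm_dev_le_beta x)
    also have "\<dots> = ennreal ((beta K \<rho> G k)\<^sup>2)" using x by (simp add: divide_ennreal)
    finally show ?thesis .
  qed
  have "ennreal (\<integral>t. N t \<partial>\<L>) = (\<integral>\<^sup>+t. ennreal (N t) \<partial>\<L>)"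
    using int N0 by (subst nn_integral_eq_integral) (auto simp: N_def[symmetric])
  also have "\<dots> = (\<integral>\<^sup>+t. \<integral>\<^sup>+x. ennreal (q t) * ennreal ((f x)\<^sup>2) \<partial>U t \<partial>\<L>)"
  proof (rule nn_integral_cong_AE, use Nn in eventually_elim)
    case (elim t)
    \<comment> \<open>If \<open>n t = 0\<close>, then \<open>q t = 0\<close> by division by zero,
      and \<open>N t <= n t\<close> forces \<open>N t = 0\<close>.\<close>
    have "N t = q t * n t" using elim N0[of t] by (cases "n t = 0") (auto simp: q_def)
    then have "ennreal (N t) = ennreal (q t) * ennreal (n t)" using q0 n0 by (simp add: ennreal_mult)
    also have "ennreal (n t) = (\<integral>\<^sup>+x. ennreal ((f x)\<^sup>2) \<partial>U t)"
      using elim by (simp add: nn_integral_square_L2 n_def)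
    also have "ennreal (q t) * \<dots> = (\<integral>\<^sup>+x. ennreal (q t) * ennreal ((f x)\<^sup>2) \<partial>U t)"
      by (rule nn_integral_cmult[symmetric]) measurable
    finally show ?case .
  qed
  also have "\<dots> = (\<integral>\<^sup>+x. \<integral>\<^sup>+t. ennreal (q t) * ennreal ((f x)\<^sup>2) \<partial>height x \<partial>\<pi>)"
    by (rule nn_integral_slice_fubini[symmetric]) measurable
  also have "\<dots> \<le> (\<integral>\<^sup>+x. ennreal ((beta K \<rho> G k)\<^sup>2) * ennreal ((f x)\<^sup>2) \<partial>\<pi>)"
  proof (rule nn_integral_mono_AE, use AE_pi in eventually_elim)
    case (elim x)
    have "(\<integral>\<^sup>+t. ennreal (q t) * ennreal ((f x)\<^sup>2) \<partial>height x) = (\<integral>\<^sup>+t. ennreal (q t) \<partial>height x) * ennreal ((f x)\<^sup>2)"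
      by (rule nn_integral_multc) measurable
    then show ?case using height_q[of x] elim by (simp add: mult_right_mono)
  qed
  also have "\<dots> = ennreal ((beta K \<rho> G k)\<^sup>2 * ip \<pi> f f)"
    by (subst nn_integral_cmult) (auto simp: nn_integral_square_L2[OF f] ennreal_mult ip_nonneg)
  finally show "(\<integral>t. ip (U t) (dev k t f) (dev k t f) \<partial>\<L>) \<le> (beta K \<rho> G k)\<^sup>2 * ip \<pi> f f"
    unfolding N_def[symmetric] by (simp add: ip_nonneg)
qed

section \<open>Lower bound\<close>

lemma hybrid_moment_bound:
  assumes f: "f \<in> L2space \<pi>" and b: "beta K \<rho> G k < b"
  shows "real k * (ip \<pi> (hybrid \<rho> G f) f - ip \<pi> f f)
    \<le> ip \<pi> (hybrid \<rho> (\<lambda>t x. U t) f) f + b * ip \<pi> f f - ip \<pi> f f"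
proof -
  \<comment> \<open>\<open>beta\<close> can be 0 while the weighted Cauchy-Schwarz inequality
    divides by its weight, hence a strictly larger \<open>b\<close>. With this weight both halves of
    the bound on the deviation term integrate to at most \<open>b / 2\<close> times the squared norm
    of \<open>f\<close>.\<close>
  have b0: "0 < b" using b beta_nonneg[of k] by simp
  let ?kop = "\<lambda>t. ip (U t) (kop G t f) f" and ?n = "\<lambda>t. ip (U t) f f"
    and ?u = "\<lambda>t. ip (U t) (kop (\<lambda>t x. U t) t f) f" and ?d = "\<lambda>t. ip (U t) (dev k t f) (dev k t f)"
  note int = integrable_ip_kop[OF f f] integrable_ip_unif[OF f] simple.integrable_ip_kop[OF f f]
    integrable_ip_dev[OF f, of k]
  have "(\<integral>t. real k * (?kop t - ?n t) \<partial>\<L>) \<le> (\<integral>t. ?u t + (?d t / b + b * ?n t) / 2 - ?n t \<partial>\<L>)"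
  proof (rule integral_mono_AE)
    show "AE t in \<L>. real k * (?kop t - ?n t) \<le> ?u t + (?d t / b + b * ?n t) / 2 - ?n t"
      using AE_L2space_unif[OF f] AE_ell_regular G_psd
    proof eventually_elim
      case (elim t)
      interpret prob_space "U t" using elim by (intro prob_space_unif)
      have const: "(\<lambda>x. d) \<in> L2space (U t)" for d by (rule L2space_const) unfold_locales
      have dev: "dev k t f \<in> L2space (U t)" by (rule dev_L2(1)[OF elim(2,1)])
      have "real k * (?kop t - ?n t) \<le> ip (U t) (kpow G t k f) f - ?n t"
        unfolding kpow_def by (rule psd_moment_bernoulli[OF sym_op_kop[OF elim(2)] elim(3,1)])
      also have "kpow G t k f = (\<lambda>x. dev k t f x + (\<integral>z. f z \<partial>U t))"
        by (simp add: dev_def)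
      also have "ip (U t) \<dots> f = ip (U t) (dev k t f) f + ?u t"
        using ip_add_left[OF dev const elim(1)] by (simp add: kop_def[abs_def])
      also have "ip (U t) (dev k t f) f \<le> (?d t / b + b * ?n t) / 2"
        using ip_le_weighted[OF dev elim(1) b0] by simp
      finally show ?case by simp
    qed
  qed (use int in auto)
  also have "(\<integral>t. real k * (?kop t - ?n t) \<partial>\<L>) = real k * (ip \<pi> (hybrid \<rho> G f) f - ip \<pi> f f)"
    using int by (simp add: ip_hybrid[OF f f] integral_ip_unif[OF f])
  also have "(\<integral>t. ?u t + (?d t / b + b * ?n t) / 2 - ?n t \<partial>\<L>)
      = ip \<pi> (hybrid \<rho> (\<lambda>t x. U t) f) f + ((\<integral>t. ?d t \<partial>\<L>) / b + b * ip \<pi> f f) / 2 - ip \<pi> f f"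
    using int by (simp add: simple.ip_hybrid[OF f f] integral_ip_unif[OF f])
  also have "(\<integral>t. ?d t \<partial>\<L>) / b \<le> b * ip \<pi> f f"
  proof -
    have "(\<integral>t. ?d t \<partial>\<L>) \<le> (beta K \<rho> G k)\<^sup>2 * ip \<pi> f f" by (rule integral_ip_dev_le[OF f])
    also have "\<dots> \<le> b\<^sup>2 * ip \<pi> f f"
      using b beta_nonneg[of k] by (intro mult_right_mono power_mono ip_nonneg) auto
    finally show ?thesis using b0 by (simp add: field_simps power2_eq_square)
  qed
  finally show ?thesis by simp
qed

lemma gap_hybrid_ge:
  assumes k: "1 \<le> k"
  shows "(gap \<pi> (simple_slice K \<rho>) - beta K \<rho> G k) / real k \<le> gap \<pi> (hybrid \<rho> G)"
proof (rule field_le_epsilon)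
  fix e :: real assume "0 < e"
  define u where "u = opnorm \<pi> simple.centered"
  define b where "b = beta K \<rho> G k + e"
  have b: "beta K \<rho> G k < b" "0 \<le> b" using \<open>0 < e\<close> beta_nonneg[of k] by (auto simp: b_def)
  have u: "0 \<le> u" by (simp add: u_def opnorm_nonneg)
  define r where "r = 1 - (1 - u - b) / real k"
  have k1: "1 \<le> real k" using k by simp
  \<comment> \<open>Holds because \<open>1 - u - b <= 1 <= real k\<close>.\<close>
  have r0: "0 \<le> r"
    using u b k1 by (simp add: r_def field_simps)
  have "opnorm \<pi> centered \<le> r"
  proof (rule opnorm_le_quadratic_form[OF sym_op_centered psd_op_centered r0])
    fix f assume f: "f \<in> L2space \<pi>"
    define s where "s = (\<integral>x. f x \<partial>\<pi>)"
    define m where "m = ip \<pi> f f"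
    have "real k * (ip \<pi> (hybrid \<rho> G f) f - m) \<le> ip \<pi> (hybrid \<rho> (\<lambda>t x. U t) f) f + b * m - m"
      unfolding m_def by (rule hybrid_moment_bound[OF f b(1)])
    \<comment> \<open>Only the form of \<open>U - S\<close> is controlled by \<open>u\<close>; the
      form of \<open>U\<close> itself carries the extra square of the mean.\<close>
    also have "ip \<pi> (hybrid \<rho> (\<lambda>t x. U t) f) f \<le> u * m + s * s"
      using simple.quadratic_form_centered_le[OF f] simple.ip_centered[OF f f] by (simp add: u_def m_def s_def)
    finally have "real k * (ip \<pi> (hybrid \<rho> G f) f - m) \<le> s * s - (1 - u - b) * m"
      by (simp add: algebra_simps)
    \<comment> \<open>The square of the mean is enlarged using \<open>k >= 1\<close>, so that
      division by \<open>k\<close> returns exactly \<open>s * s\<close>, the term subtracted in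
      \<open>centered\<close>.\<close>
    also have "\<dots> \<le> real k * (s * s) - (1 - u - b) * m"
      using mult_right_mono[OF k1, of "s * s"] by simp
    also have "\<dots> = real k * (s * s - (1 - u - b) / real k * m)"
      using k1 by (simp add: right_diff_distrib)
    finally have "ip \<pi> (hybrid \<rho> G f) f - m \<le> s * s - (1 - u - b) / real k * m"
      using k1 by simp
    then show "ip \<pi> (centered f) f \<le> r * ip \<pi> f f"
      by (simp add: ip_centered[OF f f] r_def m_def s_def algebra_simps)
  qed
  then have "(1 - u - b) / real k \<le> gap \<pi> (hybrid \<rho> G)" by (simp add: gap_hybrid r_def)
  \<comment> \<open>The slack costs \<open>e / k\<close>, which is at most \<open>e\<close>.\<close>
  moreover have "(1 - u - beta K \<rho> G k) / real k \<le> (1 - u - b) / real k + e"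
    using k1 \<open>0 < e\<close> by (simp add: b_def field_simps)
  ultimately show "(gap \<pi> (simple_slice K \<rho>) - beta K \<rho> G k) / real k \<le> gap \<pi> (hybrid \<rho> G) + e"
    by (simp add: simple_slice_eq_hybrid simple.gap_hybrid u_def)
qed

end

theorem theorem3p3:
  fixes K :: "'a::euclidean_space set" and \<rho> :: "'a \<Rightarrow> real"
    and H :: "real \<Rightarrow> 'a \<Rightarrow> 'a measure" and k :: nat
  assumes K_borel: "K \<in> sets borel"
    and \<rho>_meas: "\<rho> \<in> borel_measurable borel"
    and \<rho>_nonneg: "\<And>x. x \<in> K \<Longrightarrow> 0 \<le> \<rho> x"
    and int_pos: "0 < (\<integral>\<^sup>+x\<in>K. ennreal (\<rho> x) \<partial>lborel)"
    and int_fin: "(\<integral>\<^sup>+x\<in>K. ennreal (\<rho> x) \<partial>lborel) < \<infinity>"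
    and vol: "\<And>t. 0 < t \<Longrightarrow> ereal t < rho_sup K \<rho> \<Longrightarrow>
               0 < emeasure lborel (lvl K \<rho> t) \<and> emeasure lborel (lvl K \<rho> t) < \<infinity>"
    and H_meas: "(\<lambda>(t, x). H t x) \<in> borel \<Otimes>\<^sub>M borel \<rightarrow>\<^sub>M subprob_algebra borel"
    and H_zero: "\<And>t x. x \<notin> lvl K \<rho> t \<Longrightarrow> H t x = null_measure borel"
    and H_prob: "\<And>t x. 0 < t \<Longrightarrow> ereal t < rho_sup K \<rho> \<Longrightarrow> x \<in> lvl K \<rho> t \<Longrightarrow>
               prob_space (H t x) \<and> sets (H t x) = sets borel \<and> emeasure (H t x) (lvl K \<rho> t) = 1"
    and H_rev: "\<And>t A B. 0 < t \<Longrightarrow> ereal t < rho_sup K \<rho> \<Longrightarrow> A \<in> sets borel \<Longrightarrow> B \<in> sets borel \<Longrightarrow>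
               (\<integral>\<^sup>+x. indicator A x * emeasure (H t x) B \<partial>unif K \<rho> t)
             = (\<integral>\<^sup>+x. indicator B x * emeasure (H t x) A \<partial>unif K \<rho> t)"
    and H_psd: "AE t in ell K \<rho>. \<forall>f\<in>L2space (unif K \<rho> t).
               0 \<le> (\<integral>x. kop H t f x * f x \<partial>unif K \<rho> t)"
    and beta_lim: "(\<lambda>k. beta K \<rho> H k) \<longlonglongrightarrow> 0"
    and k_pos: "1 \<le> k"
  shows "(gap (pi_meas K \<rho>) (simple_slice K \<rho>) - beta K \<rho> H k) / real k
           \<le> gap (pi_meas K \<rho>) (hybrid \<rho> H)
       \<and> gap (pi_meas K \<rho>) (hybrid \<rho> H) \<le> gap (pi_meas K \<rho>) (simple_slice K \<rho>)"
proof -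
  interpret D: slice_density K \<rho> by unfold_locales fact+
  interpret slice_kernel K \<rho> H
  proof (intro slice_kernel.intro slice_kernel_axioms.intro D.slice_density_axioms)
    show "AE t in ell K \<rho>. psd_op (unif K \<rho> t) (kop H t)"
      using H_psd by (simp add: psd_op_def ip_def)
  qed (use H_meas H_prob H_rev in \<open>auto simp: D.regular_def\<close>)
  show ?thesis using gap_hybrid_ge[OF k_pos] gap_hybrid_le_gap_simple by simp
qed

end
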